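(* Let $A$ be a $d\times n$ integer matrix of rank $d$ with columns $a_1,\dots,a_n\in\mathbb{Z}^d$. There exists $\lambda\in(\mathbb{C}^* )^n$ such that the toric variety $X_{\lambda,A}\subset\mathbb{C}^n$ is positively hyperbolic if and only if, up to the action of $\mathrm{GL}_d(\mathbb{Q})$ on the left, the columns of $A$ belong to $\{0\}\cup\{\pm e_i\}_{i\in[d]}$ and the supports of the rows of $A$ form a non-crossing partition of a subset of $[n]$. Moreover, in this case one can always take $\lambda\in\{\pm1\}^n$.
   Context: For $\lambda\in(\mathbb{C}^* )^n$, $X_{\lambda,A}\subset\mathbb{C}^n$ is the (Zariski closure of the) image of $(\mathbb{C}^* )^d\to(\mathbb{C}^* )^n$, $x\mapsto(\lambda_1x^{a_1},\dots,\lambda_nx^{a_n})$. $e_i$ denotes the $i$-th standard basis vector of $\mathbb{R}^d$. Subsets $S_1,\dots,S_k\subset[n]$ form a non-crossing partition of a subset of $[n]$ if they are pairwise disjoint and there are no $a,b,c,d$ in cyclic order with $a,c\in S_i$, $b,d\in S_j$, $i\ne j$. $\mathrm{Gr}_+(c,n)$ is the set of $c$-dimensional subspaces of $\mathbb{R}^n$ that are row spaces of real $c\times n$ matrices with all maximal minors positive. An equidimensional variety $X\subset\mathbb{C}^n$ of codimension $c\le n-1$ is positively hyperbolic if for all $L\in\mathrm{Gr}_+(c,n)$ and $x\in X$, $\operatorname{Im}(x)=(\operatorname{Im}x_1,\dots,\operatorname{Im}x_n)\notin L\setminus\{0\}$. *)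

theory Defs
  imports
    Complex_Main
    "Jordan_Normal_Form.DL_Rank"
    "Jordan_Normal_Form.DL_Submatrix"
begin

text \<open>
  Vectors and matrices have explicit dimensions and are indexed from 0, so that
  the index set written \<open>[n]\<close> in the literature is \<open>{..<n}\<close>.
\<close>


section \<open>Affine varieties in complex n-space\<close>

text \<open>
  Since the complex numbers are infinite, polynomials in \<open>n\<close> variables are
  identified with the functions they induce on \<open>carrier_vec n\<close>; the values of such a
  function outside \<open>carrier_vec n\<close> are irrelevant.
\<close>

inductive_set polynomial_functions :: "nat \<Rightarrow> (complex vec \<Rightarrow> complex) set" for n :: nat where
  const: "(\<lambda>_. a) \<in> polynomial_functions n"
| coord: "i < n \<Longrightarrow> (\<lambda>x. x $ i) \<in> polynomial_functions n"
| add: "f \<in> polynomial_functions n \<Longrightarrow> g \<in> polynomial_functions n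
    \<Longrightarrow> (\<lambda>x. f x + g x) \<in> polynomial_functions n"
| mult: "f \<in> polynomial_functions n \<Longrightarrow> g \<in> polynomial_functions n
    \<Longrightarrow> (\<lambda>x. f x * g x) \<in> polynomial_functions n"

definition algebraic_set :: "nat \<Rightarrow> complex vec set \<Rightarrow> bool" where
  "algebraic_set n X \<longleftrightarrow>
     (\<exists>F \<subseteq> polynomial_functions n. X = {x \<in> carrier_vec n. \<forall>f\<in>F. f x = 0})"

definition zariski_closure :: "nat \<Rightarrow> complex vec set \<Rightarrow> complex vec set" where
  "zariski_closure n S = \<Inter> {X. algebraic_set n X \<and> S \<subseteq> X}"

definition irreducible_variety :: "nat \<Rightarrow> complex vec set \<Rightarrow> bool" where
  "irreducible_variety n X \<longleftrightarrow> algebraic_set n X \<and> X \<noteq> {} \<and>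
     (\<forall>Y Z. algebraic_set n Y \<and> algebraic_set n Z \<and> X = Y \<union> Z \<longrightarrow> X = Y \<or> X = Z)"

definition irreducible_component :: "nat \<Rightarrow> complex vec set \<Rightarrow> complex vec set \<Rightarrow> bool" where
  "irreducible_component n X Y \<longleftrightarrow> irreducible_variety n Y \<and> Y \<subseteq> X \<and>
     (\<forall>Z. irreducible_variety n Z \<and> Y \<subseteq> Z \<and> Z \<subseteq> X \<longrightarrow> Z = Y)"

text \<open>
  Algebraic independence over the complex numbers of the elements
  \<open>fs 0, \<dots>, fs (k - 1)\<close> of the coordinate ring of \<open>X\<close>.
\<close>

definition algebraically_independent_on ::
    "complex vec set \<Rightarrow> nat \<Rightarrow> (nat \<Rightarrow> complex vec \<Rightarrow> complex) \<Rightarrow> bool" where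
  "algebraically_independent_on X k fs \<longleftrightarrow>
     (\<forall>p \<in> polynomial_functions k.
        (\<forall>x\<in>X. p (vec k (\<lambda>j. fs j x)) = 0) \<longrightarrow> (\<forall>y\<in>carrier_vec k. p y = 0))"

text \<open>
  The dimension of an irreducible variety is the transcendence degree of its
  coordinate ring. The set of such \<open>k\<close> is bounded by \<open>n\<close>, so the greatest element exists.
\<close>

definition irreducible_dim :: "nat \<Rightarrow> complex vec set \<Rightarrow> nat" where
  "irreducible_dim n X = (GREATEST k. \<exists>fs.
     (\<forall>j<k. fs j \<in> polynomial_functions n) \<and> algebraically_independent_on X k fs)"

text \<open>Nonemptiness makes the codimension unique.\<close>

definition equidimensional_codim :: "nat \<Rightarrow> nat \<Rightarrow> complex vec set \<Rightarrow> bool" where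
  "equidimensional_codim n c X \<longleftrightarrow> algebraic_set n X \<and> X \<noteq> {} \<and>
     (\<forall>Y. irreducible_component n X Y \<longrightarrow> irreducible_dim n Y + c = n)"


section \<open>Positive Grassmannian and positive hyperbolicity\<close>

text \<open>
  For \<open>c \<le> n\<close>, positivity of the maximal minors forces the row space to have dimension
  \<open>c\<close>. For \<open>c = 0\<close> the only (empty) minor is 1, and the set is \<open>{{0\<^sub>v n}}\<close>.
\<close>

definition positive_grassmannian :: "nat \<Rightarrow> nat \<Rightarrow> real vec set set" where
  "positive_grassmannian c n =
     {vec_space.row_space n M | M. M \<in> carrier_mat c n \<and>
        (\<forall>J. J \<subseteq> {..<n} \<and> card J = c \<longrightarrow> det (submatrix M UNIV J) > 0)}"

definition positively_hyperbolic :: "nat \<Rightarrow> complex vec set \<Rightarrow> bool" where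
  "positively_hyperbolic n X \<longleftrightarrow>
     (\<exists>c<n. equidimensional_codim n c X \<and>
        (\<forall>L \<in> positive_grassmannian c n. \<forall>x\<in>X. map_vec Im x \<notin> L - {0\<^sub>v n}))"


section \<open>Toric varieties\<close>

definition complex_torus :: "nat \<Rightarrow> complex vec set" where
  "complex_torus m = {x \<in> carrier_vec m. \<forall>i<m. x $ i \<noteq> 0}"

definition scaled_monomial_map :: "complex vec \<Rightarrow> int mat \<Rightarrow> complex vec \<Rightarrow> complex vec" where
  "scaled_monomial_map l A x =
     vec (dim_col A) (\<lambda>j. l $ j * (\<Prod>i<dim_row A. (x $ i) powi (A $$ (i, j))))"

definition toric_variety :: "complex vec \<Rightarrow> int mat \<Rightarrow> complex vec set" where
  "toric_variety l A =
     zariski_closure (dim_col A) (scaled_monomial_map l A ` complex_torus (dim_row A))"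


section \<open>Non-crossing partitions\<close>

definition cyclic_order4 :: "nat \<Rightarrow> nat \<Rightarrow> nat \<Rightarrow> nat \<Rightarrow> bool" where
  "cyclic_order4 a b c d \<longleftrightarrow>
     (a < b \<and> b < c \<and> c < d) \<or> (b < c \<and> c < d \<and> d < a) \<or>
     (c < d \<and> d < a \<and> a < b) \<or> (d < a \<and> a < b \<and> b < c)"

definition noncrossing_partial_partition :: "nat \<Rightarrow> nat \<Rightarrow> (nat \<Rightarrow> nat set) \<Rightarrow> bool" where
  "noncrossing_partial_partition n k S \<longleftrightarrow>
     (\<forall>i<k. S i \<subseteq> {..<n}) \<and>
     (\<forall>i<k. \<forall>j<k. i \<noteq> j \<longrightarrow> S i \<inter> S j = {}) \<and>
     (\<forall>i<k. \<forall>j<k. i \<noteq> j \<longrightarrow>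
        \<not> (\<exists>a b c d. cyclic_order4 a b c d \<and> a \<in> S i \<and> c \<in> S i \<and> b \<in> S j \<and> d \<in> S j))"

definition row_support :: "'a::zero mat \<Rightarrow> nat \<Rightarrow> nat set" where
  "row_support B i = {j. j < dim_col B \<and> B $$ (i, j) \<noteq> 0}"

definition signed_unit_columns :: "rat mat \<Rightarrow> bool" where
  "signed_unit_columns B \<longleftrightarrow>
     (\<forall>j<dim_col B. col B j \<in> {0\<^sub>v (dim_row B)}
        \<union> {unit_vec (dim_row B) i | i. i < dim_row B}
        \<union> {- unit_vec (dim_row B) i | i. i < dim_row B})"

definition noncrossing_up_to_GL :: "int mat \<Rightarrow> bool" where
  "noncrossing_up_to_GL A \<longleftrightarrow>
     (\<exists>G \<in> carrier_mat (dim_row A) (dim_row A). invertible_mat G \<and>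
        (let B = G * map_mat rat_of_int A in
           signed_unit_columns B \<and>
           noncrossing_partial_partition (dim_col B) (dim_row B) (row_support B)))"

end

theory Submission
  imports Defs "HOL-Library.Function_Algebras"
begin

text \<open>
  By total positivity, a vector \<open>v\<close> lies in some member of the positive Grassmannian of
  codimension \<open>d\<close> as soon as \<open>j \<mapsto> (-1) ^ j * v j\<close> strictly alternates in sign along some
  \<open>d + 1\<close> indices, whereas a nonzero \<open>v\<close> lies in no member if \<open>v\<close> itself weakly alternates along
  \<open>n - d + 1\<close> indices.

  On the points of the toric variety with \<open>\<bar>x i\<bar> = 1\<close> the signs of the imaginary parts are those
  of sines of affine functions of the angles. The signs at \<open>d\<close> columns of \<open>A\<close> forming a basis can be
  prescribed, so positive hyperbolicity restricts the sign at every further column. Near a common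
  zero of the sines of the basis columns this forces the coordinates \<open>Q\<close> of the further column to be
  integers, and then to have at most one nonzero entry, which is \<open>\<plusminus>1\<close>. For a crossing
  \<open>j1 < j2 < j3 < j4\<close>, the columns \<open>j1\<close> and \<open>j3\<close> together with either \<open>j2\<close> or \<open>j4\<close> and
  representatives of the other blocks impose opposite conditions on the relative sign of \<open>j1\<close> and \<open>j3\<close>.

  Conversely, let \<open>l j\<close> be the sign of the entry of column \<open>j\<close>, switched at every index that is not
  the least element of a block. For each point, omitting a suitable one of the two extreme elements
  of every block but the first leaves \<open>n - d + 1\<close> indices along which the imaginary parts weakly
  alternate.
\<close>

section \<open>Column bases\<close>

text \<open>A maximal independent set of columns has \<open>d\<close> elements by the rank
  assumption. The square matrix \<open>N\<close> formed by them is invertible, and multiplication by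
  its inverse \<open>G\<close> turns them into the unit vectors.\<close>

lemma full_rank_column_basis:
  fixes M :: "'a :: field mat"
  assumes M: "M \<in> carrier_mat d n" and rank: "vec_space.rank d M = d"
  obtains G b where "G \<in> carrier_mat d d" "invertible_mat G" "\<And>i. i < d \<Longrightarrow> b i < n"
    "\<And>i k. i < d \<Longrightarrow> k < d \<Longrightarrow> (G * M) $$ (i, b k) = (if i = k then 1 else 0)"
proof -
  interpret vec_space "TYPE('a)" d .
  obtain S where S: "maximal S (\<lambda>T. T \<subseteq> set (cols M) \<and> lin_indpt T)"
    using maximal_exists_superset[of "set (cols M)" "\<lambda>T. T \<subseteq> set (cols M) \<and> lin_indpt T" "{}"]
    by (metis List.finite_set empty_iff empty_subsetI finite_lin_indpt2 finite.emptyI)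
  have cardS: "card S = d" using rank_card_indpt[OF M S] rank by simp
  have Ssub: "S \<subseteq> set (cols M)" and li: "lin_indpt S" using S unfolding maximal_def by auto
  obtain xs where xs: "set xs = S" "distinct xs"
    using finite_distinct_list finite_subset[OF Ssub] by blast
  have len: "length xs = d" using xs cardS distinct_card by fastforce
  have "\<forall>i<d. \<exists>j<n. col M j = xs ! i"
  proof (intro allI impI)
    fix i assume "i < d"
    then have "xs ! i \<in> set (cols M)" using len xs Ssub nth_mem by blast
    then show "\<exists>j<n. col M j = xs ! i" using M by (auto simp: cols_def)
  qed
  then obtain b where b: "\<And>i. i < d \<Longrightarrow> b i < n \<and> col M (b i) = xs ! i" by metis
  define N where "N = mat d d (\<lambda>(i, k). M $$ (i, b k))"
  have N: "N \<in> carrier_mat d d" by (simp add: N_def)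
  have colN: "col N k = xs ! k" if "k < d" for k
    using b[OF that] M that unfolding N_def by (auto simp: vec_eq_iff)
  have colsN: "cols N = xs"
    using len N by (intro nth_equalityI) (auto simp: colN)
  have "rank N = d"
    using lin_indpt_full_rank[OF N] colsN xs li by simp
  then have "det N \<noteq> 0" using det_rank_iff[OF N] by simp
  then obtain G where G: "G \<in> carrier_mat d d" "G * N = 1\<^sub>m d" "N * G = 1\<^sub>m d"
    using det_non_zero_imp_unit[OF N] unfolding Units_def ring_mat_def by auto
  show thesis
  proof
    show "G \<in> carrier_mat d d" by fact
    show "invertible_mat G"
      using G N unfolding invertible_mat_def inverts_mat_def by auto
    show "b i < n" if "i < d" for i using b that by blast
    show "(G * M) $$ (i, b k) = (if i = k then 1 else 0)" if "i < d" "k < d" for i k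
    proof -
      have "(G * M) $$ (i, b k) = row G i \<bullet> col M (b k)"
        using that G M b by simp
      also have "\<dots> = (G * N) $$ (i, k)"
        using that G(1) N b colN by simp
      finally show ?thesis using G that by simp
    qed
  qed
qed

section \<open>Irreducibility and dimension of toric varieties\<close>

text \<open>The closure is the zero set of the vanishing ideal of \<open>S\<close>, so every
  polynomial relation valid on \<open>S\<close> extends to it.\<close>

lemma zariski_closure_eq:
  assumes S: "S \<subseteq> carrier_vec n"
  shows "zariski_closure n S =
    {x \<in> carrier_vec n. \<forall>f \<in> polynomial_functions n. (\<forall>s\<in>S. f s = 0) \<longrightarrow> f x = 0}"
    (is "_ = ?R")
proof
  have "algebraic_set n ?R"
    unfolding algebraic_set_def
    by (intro exI[of _ "{f \<in> polynomial_functions n. \<forall>s\<in>S. f s = 0}"]) auto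
  then show "zariski_closure n S \<subseteq> ?R" using S unfolding zariski_closure_def by auto
  show "?R \<subseteq> zariski_closure n S"
    unfolding zariski_closure_def algebraic_set_def by auto
qed

lemma algebraic_set_zariski_closure:
  assumes "S \<subseteq> carrier_vec n"
  shows "algebraic_set n (zariski_closure n S)"
  unfolding zariski_closure_eq[OF assms] algebraic_set_def
  by (intro exI[of _ "{f \<in> polynomial_functions n. \<forall>s\<in>S. f s = 0}"]) auto

lemma subset_zariski_closure: "S \<subseteq> zariski_closure n S"
  unfolding zariski_closure_def by auto

text \<open>The hypothesis \<open>prime\<close> says that the vanishing ideal of \<open>S\<close> is
  prime. Of two proper closed subsets covering the closure, each would be annihilated by a
  polynomial not identically zero on \<open>S\<close>, and the product of the two contradicts
  primality.\<close>

lemma irreducible_zariski_closureI: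
  assumes S: "S \<subseteq> carrier_vec n" "S \<noteq> {}"
    and prime: "\<And>f g. f \<in> polynomial_functions n \<Longrightarrow> g \<in> polynomial_functions n \<Longrightarrow>
      (\<And>s. s \<in> S \<Longrightarrow> f s * g s = 0) \<Longrightarrow> (\<forall>s\<in>S. f s = 0) \<or> (\<forall>s\<in>S. g s = 0)"
  shows "irreducible_variety n (zariski_closure n S)"
proof -
  let ?X = "zariski_closure n S"
  have sub: "\<exists>f \<in> polynomial_functions n. (\<forall>y\<in>Y. f y = 0) \<and> (\<exists>s\<in>S. f s \<noteq> 0)"
    if Y: "algebraic_set n Y" "Y \<subseteq> ?X" "Y \<noteq> ?X" for Y
  proof -
    obtain F where F: "F \<subseteq> polynomial_functions n" "Y = {x \<in> carrier_vec n. \<forall>f\<in>F. f x = 0}"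
      using Y(1) unfolding algebraic_set_def by auto
    have "\<not> S \<subseteq> Y" using Y unfolding zariski_closure_def by auto
    then show ?thesis using F S(1) by blast
  qed
  show ?thesis
    unfolding irreducible_variety_def
  proof (intro conjI allI impI)
    fix Y Z assume YZ: "algebraic_set n Y \<and> algebraic_set n Z \<and> ?X = Y \<union> Z"
    show "?X = Y \<or> ?X = Z"
    proof (rule ccontr)
      assume "\<not> ?thesis"
      then obtain f g where fg: "f \<in> polynomial_functions n" "g \<in> polynomial_functions n"
        "\<forall>y\<in>Y. f y = 0" "\<exists>s\<in>S. f s \<noteq> 0" "\<forall>z\<in>Z. g z = 0" "\<exists>s\<in>S. g s \<noteq> 0"
        using sub[of Y] sub[of Z] YZ by blast
      have "f s * g s = 0" if "s \<in> S" for s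
        using subset_zariski_closure[of S n] that YZ fg by auto
      then show False using prime[OF fg(1,2)] fg by blast
    qed
  qed (use algebraic_set_zariski_closure[OF S(1)] subset_zariski_closure[of S n] S(2) in auto)
qed

text \<open>An irreducible variety is its own only irreducible component.\<close>

lemma equidimensional_codim_irreducible_iff:
  assumes X: "irreducible_variety n X"
  shows "equidimensional_codim n c X \<longleftrightarrow> irreducible_dim n X + c = n"
proof -
  have "irreducible_component n X Y \<longleftrightarrow> Y = X" for Y
    using X unfolding irreducible_component_def by blast
  then show ?thesis
    using X unfolding equidimensional_codim_def irreducible_variety_def by simp
qed

lemma polynomial_functions_prod:
  assumes "\<And>i. i \<in> I \<Longrightarrow> f i \<in> polynomial_functions n"
  shows "(\<lambda>x. \<Prod>i\<in>I. f i x) \<in> polynomial_functions n"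
  using assms
  by (induction I rule: infinite_finite_induct) (auto intro: polynomial_functions.intros)

lemma polynomial_functions_sum:
  assumes "\<And>i. i \<in> I \<Longrightarrow> f i \<in> polynomial_functions n"
  shows "(\<lambda>x. \<Sum>i\<in>I. f i x) \<in> polynomial_functions n"
  using assms
  by (induction I rule: infinite_finite_induct) (auto intro: polynomial_functions.intros)

lemma polynomial_functions_power:
  assumes "f \<in> polynomial_functions n"
  shows "(\<lambda>x. f x ^ m) \<in> polynomial_functions n"
  using assms by (induction m) (auto intro: polynomial_functions.intros)

section \<open>Restriction of Laurent polynomials to lines\<close>

definition line :: "nat \<Rightarrow> complex vec \<Rightarrow> complex vec \<Rightarrow> complex \<Rightarrow> complex vec" where
  "line d x y t = vec d (\<lambda>i. x $ i + t * (y $ i - x $ i))"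

text \<open>Its non-roots are the parameters at which the line lies in the torus.\<close>

definition line_denom :: "nat \<Rightarrow> complex vec \<Rightarrow> complex vec \<Rightarrow> complex poly" where
  "line_denom d x y = (\<Prod>i<d. [:x $ i, y $ i - x $ i:])"

lemma line_simps [simp]:
  "x \<in> carrier_vec d \<Longrightarrow> line d x y 0 = x"
  "y \<in> carrier_vec d \<Longrightarrow> line d x y 1 = y"
  by (auto simp: line_def)

lemma poly_line_denom: "poly (line_denom d x y) t = (\<Prod>i<d. line d x y t $ i)"
  by (simp add: line_denom_def poly_prod line_def)

lemma line_denom_nonzero:
  assumes "x \<in> complex_torus d"
  shows "poly (line_denom d x y) 0 \<noteq> 0"
  using assms by (simp add: poly_line_denom complex_torus_def)

lemma polynomial_function_on_line:
  assumes "f \<in> polynomial_functions d"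
  shows "\<exists>P. \<forall>t. f (line d x y t) = poly P t"
  using assms
proof (induction rule: polynomial_functions.induct)
  case (const a)
  show ?case by (intro exI[of _ "[:a:]"]) simp
next
  case (coord i)
  then show ?case by (intro exI[of _ "[:x $ i, y $ i - x $ i:]"]) (simp add: line_def)
next
  case (add f g)
  then obtain P R where "\<forall>t. f (line d x y t) = poly P t" "\<forall>t. g (line d x y t) = poly R t" by blast
  then show ?case by (intro exI[of _ "P + R"]) simp
next
  case (mult f g)
  then obtain P R where "\<forall>t. f (line d x y t) = poly P t" "\<forall>t. g (line d x y t) = poly R t" by blast
  then show ?case by (intro exI[of _ "P * R"]) simp
qed

text \<open>On the line from the all-ones vector to \<open>y\<close>, the product of
  \<open>p\<close> and \<open>line_denom\<close> vanishes for every parameter. The second factor is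
  a nonzero polynomial, so \<open>p\<close> vanishes along the whole line, in particular at
  \<open>y\<close>.\<close>

lemma polynomial_function_zero_on_torus:
  assumes p: "p \<in> polynomial_functions d" and zero: "\<And>w. w \<in> complex_torus d \<Longrightarrow> p w = 0"
    and y: "y \<in> carrier_vec d"
  shows "p y = 0"
proof -
  define x :: "complex vec" where "x = vec d (\<lambda>_. 1)"
  have x: "x \<in> complex_torus d" by (simp add: x_def complex_torus_def)
  obtain P where P: "\<And>t. p (line d x y t) = poly P t"
    using polynomial_function_on_line[OF p] by blast
  have "poly (P * line_denom d x y) t = 0" for t
  proof (cases "poly (line_denom d x y) t = 0")
    case False
    then have "line d x y t \<in> complex_torus d"
      by (auto simp: poly_line_denom complex_torus_def line_def)
    then show ?thesis using zero[of "line d x y t"] P[of t] by simp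
  qed simp
  then have "P * line_denom d x y = 0" using poly_all_0_iff_0 by blast
  then have "P = 0" using line_denom_nonzero[OF x, of y] by auto
  then show ?thesis using P[of 1] y by simp
qed

text \<open>Being a polynomial divided by a power of \<open>line_denom\<close> is preserved under
  sums and products. The coordinates of the line and their inverses have this form, because each
  coordinate is a factor of \<open>line_denom\<close>.\<close>

lemma laurent_on_line:
  assumes A: "A \<in> carrier_mat d n" and f: "f \<in> polynomial_functions n"
  shows "\<exists>P N. \<forall>t. poly (line_denom d x y) t \<noteq> 0 \<longrightarrow>
    f (scaled_monomial_map l A (line d x y t)) * poly (line_denom d x y) t ^ N = poly P t"
proof -
  define D where "D = line_denom d x y"
  define rational where "rational g \<longleftrightarrow> (\<exists>P N. \<forall>t. poly D t \<noteq> 0 \<longrightarrow> g t * poly D t ^ N = poly P t)"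
    for g
  have const: "rational (\<lambda>_. a)" for a
    unfolding rational_def by (intro exI[of _ "[:a:]"] exI[of _ 0]) simp
  have mult: "rational (\<lambda>t. g t * h t)" if rg: "rational g" and rh: "rational h" for g h
  proof -
    obtain P N where "\<forall>t. poly D t \<noteq> 0 \<longrightarrow> g t * poly D t ^ N = poly P t"
      using rg unfolding rational_def by blast
    moreover obtain R M where "\<forall>t. poly D t \<noteq> 0 \<longrightarrow> h t * poly D t ^ M = poly R t"
      using rh unfolding rational_def by blast
    ultimately have "\<forall>t. poly D t \<noteq> 0 \<longrightarrow> (g t * h t) * poly D t ^ (N + M) = poly (P * R) t"
      unfolding power_add poly_mult by (metis mult.assoc mult.left_commute)
    then show ?thesis unfolding rational_def by blast
  qed
  have add: "rational (\<lambda>t. g t + h t)" if rg: "rational g" and rh: "rational h" for g h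
  proof -
    obtain P N where g: "\<forall>t. poly D t \<noteq> 0 \<longrightarrow> g t * poly D t ^ N = poly P t"
      using rg unfolding rational_def by blast
    obtain R M where h: "\<forall>t. poly D t \<noteq> 0 \<longrightarrow> h t * poly D t ^ M = poly R t"
      using rh unfolding rational_def by blast
    have "(g t + h t) * poly D t ^ (N + M) = poly (P * D ^ M + R * D ^ N) t" if "poly D t \<noteq> 0" for t
      using g[rule_format, OF that, symmetric] h[rule_format, OF that, symmetric] by (simp add: power_add algebra_simps)
    then show ?thesis unfolding rational_def by blast
  qed
  have prod: "rational (\<lambda>t. \<Prod>i\<in>I. g i t)" if "\<And>i. i \<in> I \<Longrightarrow> rational (g i)" for I and g :: "nat \<Rightarrow> _"
    using that by (induction I rule: infinite_finite_induct) (auto intro: const mult)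
  have pow: "rational (\<lambda>t. g t ^ m)" if "rational g" for g m
    using that by (induction m) (auto intro: const mult)
  have coord: "rational (\<lambda>t. line d x y t $ i)" if "i < d" for i
    unfolding rational_def using that
    by (intro exI[of _ "[:x $ i, y $ i - x $ i:]"] exI[of _ 0]) (simp add: line_def)
  have inv: "rational (\<lambda>t. inverse (line d x y t $ i))" if i: "i < d" for i
    unfolding rational_def
  proof (intro exI[of _ "\<Prod>k\<in>{..<d} - {i}. [:x $ k, y $ k - x $ k:]"] exI[of _ 1] allI impI)
    fix t assume "poly D t \<noteq> 0"
    then have "line d x y t $ i \<noteq> 0" using i by (simp add: D_def poly_line_denom)
    moreover have "poly D t = line d x y t $ i * (\<Prod>k\<in>{..<d} - {i}. line d x y t $ k)"
      using i by (simp add: D_def poly_line_denom prod.remove)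
    moreover have "(\<Prod>k\<in>{..<d} - {i}. line d x y t $ k) =
      poly (\<Prod>k\<in>{..<d} - {i}. [:x $ k, y $ k - x $ k:]) t"
      unfolding poly_prod by (intro prod.cong) (auto simp: line_def)
    ultimately show "inverse (line d x y t $ i) * poly D t ^ 1 =
      poly (\<Prod>k\<in>{..<d} - {i}. [:x $ k, y $ k - x $ k:]) t" by simp
  qed
  have "rational (\<lambda>t. f (scaled_monomial_map l A (line d x y t)))"
    using f
  proof (induction rule: polynomial_functions.induct)
    case (coord j)
    have "rational (\<lambda>t. (line d x y t $ i) powi (A $$ (i, j)))" if "i < d" for i
      unfolding power_int_def using pow[OF \<open>i < d \<Longrightarrow> rational (\<lambda>t. line d x y t $ i)\<close>]
        pow[OF inv] that assms
      by (cases "A $$ (i, j) \<ge> 0") (auto simp: \<open>\<And>i. i < d \<Longrightarrow> rational (\<lambda>t. line d x y t $ i)\<close> pow)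
    then show ?case
      using A coord unfolding scaled_monomial_map_def by (auto intro!: mult const prod)
  qed (auto intro: const add mult)
  then show ?thesis unfolding rational_def D_def .
qed

text \<open>If \<open>f\<close> is nonzero at the image of \<open>x\<close> and \<open>g\<close> at
  the image of \<open>y\<close>, both become polynomials in one variable on the line through
  \<open>x\<close> and \<open>y\<close>, up to powers of \<open>line_denom\<close>. Their product
  vanishes, so one of them is the zero polynomial, against its value at parameter 0 or 1.\<close>

lemma irreducible_toric_variety:
  assumes A: "A \<in> carrier_mat d n"
  shows "irreducible_variety n (toric_variety l A)"
proof -
  let ?S = "scaled_monomial_map l A ` complex_torus d"
  have "irreducible_variety n (zariski_closure n ?S)"
  proof (rule irreducible_zariski_closureI)
    show "?S \<subseteq> carrier_vec n" using A by (auto simp: scaled_monomial_map_def)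
    have "vec d (\<lambda>_. 1) \<in> complex_torus d" by (simp add: complex_torus_def)
    then show "?S \<noteq> {}" by blast
    fix f g assume fg: "f \<in> polynomial_functions n" "g \<in> polynomial_functions n"
      and zero: "\<And>s. s \<in> ?S \<Longrightarrow> f s * g s = 0"
    show "(\<forall>s\<in>?S. f s = 0) \<or> (\<forall>s\<in>?S. g s = 0)"
    proof (rule ccontr)
      assume "\<not> ?thesis"
      then obtain x y where x: "x \<in> complex_torus d" "f (scaled_monomial_map l A x) \<noteq> 0"
        and y: "y \<in> complex_torus d" "g (scaled_monomial_map l A y) \<noteq> 0" by auto
      have xy: "x \<in> carrier_vec d" "y \<in> carrier_vec d" using x y by (auto simp: complex_torus_def)
      let ?D = "line_denom d x y"
      obtain P N where P: "\<And>t. poly ?D t \<noteq> 0 \<Longrightarrow>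
          f (scaled_monomial_map l A (line d x y t)) * poly ?D t ^ N = poly P t"
        using laurent_on_line[OF A fg(1)] by metis
      obtain R M where R: "\<And>t. poly ?D t \<noteq> 0 \<Longrightarrow>
          g (scaled_monomial_map l A (line d x y t)) * poly ?D t ^ M = poly R t"
        using laurent_on_line[OF A fg(2)] by metis
      have D0: "poly ?D 0 \<noteq> 0" using line_denom_nonzero[OF x(1)] .
      have D1: "poly ?D 1 \<noteq> 0" using y xy by (simp add: poly_line_denom complex_torus_def)
      have "poly (P * R * ?D) t = 0" for t
      proof (cases "poly ?D t = 0")
        case False
        then have "line d x y t \<in> complex_torus d"
          by (auto simp: poly_line_denom complex_torus_def line_def)
        then have "f (scaled_monomial_map l A (line d x y t)) * g (scaled_monomial_map l A (line d x y t)) = 0"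
          using zero by blast
        then show ?thesis using P[OF False, symmetric] R[OF False, symmetric] by auto
      qed simp
      then have "P * R * ?D = 0" using poly_all_0_iff_0 by blast
      then have "P = 0 \<or> R = 0" using D0 by auto
      then show False using P[OF D0] R[OF D1] D0 D1 x y xy by auto
    qed
  qed
  then show ?thesis using A by (simp add: toric_variety_def)
qed

section \<open>Exponential coordinates and the lower bound for the dimension\<close>

lemma exists_complex_exp:
  assumes "w \<noteq> (0 :: complex)"
  shows "\<exists>a. exp a = w"
proof
  have "w = of_real (cmod w) * cis (Arg w)" using rcis_cmod_Arg[of w] by (simp add: rcis_def)
  also have "of_real (cmod w) = exp (complex_of_real (ln (cmod w)))"
    using assms by (simp add: exp_of_real)
  finally show "exp (complex_of_real (ln (cmod w)) + \<i> * of_real (Arg w)) = w"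
    by (simp add: exp_add cis_conv_exp)
qed

lemma scaled_monomial_map_exp:
  assumes "A \<in> carrier_mat d n" "j < n"
  shows "scaled_monomial_map l A (vec d (\<lambda>i. exp (z i))) $ j =
    l $ j * exp (\<Sum>i<d. of_int (A $$ (i, j)) * z i)"
  using assms by (simp add: scaled_monomial_map_def exp_sum exp_power_int)

text \<open>In exponential coordinates a rational change of basis is linear: if the logarithms
  \<open>z\<close> arise from \<open>y\<close> by the transpose of \<open>G\<close>, the exponents
  become the entries of the product of \<open>G\<close> and \<open>A\<close>, and no choice of roots
  is involved.\<close>

lemma toric_point:
  fixes y :: "nat \<Rightarrow> complex"
  assumes A: "A \<in> carrier_mat d n" and G: "G \<in> carrier_mat d d"
  shows "\<exists>x \<in> complex_torus d. \<forall>j<n. scaled_monomial_map l A x $ j =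
    l $ j * exp (\<Sum>i<d. of_rat ((G * map_mat rat_of_int A) $$ (i, j)) * y i)"
proof (intro bexI allI impI)
  define z where "z k = (\<Sum>i<d. of_rat (G $$ (i, k)) * y i)" for k
  show "vec d (\<lambda>i. exp (z i)) \<in> complex_torus d" by (simp add: complex_torus_def)
  fix j assume j: "j < n"
  have "(\<Sum>k<d. of_int (A $$ (k, j)) * z k) =
      (\<Sum>k<d. \<Sum>i<d. of_int (A $$ (k, j)) * (of_rat (G $$ (i, k)) * y i))"
    by (simp add: z_def sum_distrib_left)
  also have "\<dots> = (\<Sum>i<d. \<Sum>k<d. of_int (A $$ (k, j)) * (of_rat (G $$ (i, k)) * y i))"
    by (rule sum.swap)
  also have "\<dots> = (\<Sum>i<d. of_rat ((G * map_mat rat_of_int A) $$ (i, j)) * y i)"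
    using A G j
    by (intro sum.cong) (auto simp: scalar_prod_def lessThan_atLeast0 of_rat_sum of_rat_mult sum_distrib_right sum_distrib_left mult_ac)
  finally show "scaled_monomial_map l A (vec d (\<lambda>i. exp (z i))) $ j =
    l $ j * exp (\<Sum>i<d. of_rat ((G * map_mat rat_of_int A) $$ (i, j)) * y i)"
    using scaled_monomial_map_exp[OF A j] by simp
qed

text \<open>The coordinates at the columns \<open>b i\<close> take all tuples of nonzero values,
  since these columns become unit vectors. A polynomial relation among them thus vanishes on the
  whole torus and hence everywhere.\<close>

lemma toric_variety_dim_ge:
  assumes A: "A \<in> carrier_mat d n" and G: "G \<in> carrier_mat d d" and l: "l \<in> complex_torus n"
    and b: "\<And>i. i < d \<Longrightarrow> b i < n"
    and Gb: "\<And>i k. i < d \<Longrightarrow> k < d \<Longrightarrow> (G * map_mat rat_of_int A) $$ (i, b k) = (if i = k then 1 else 0)"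
  shows "algebraically_independent_on (toric_variety l A) d (\<lambda>i x. x $ b i)"
  unfolding algebraically_independent_on_def
proof (intro ballI impI)
  fix p :: "complex vec \<Rightarrow> complex" and u :: "complex vec"
  assume p: "p \<in> polynomial_functions d" "\<forall>x\<in>toric_variety l A. p (vec d (\<lambda>j. x $ b j)) = 0"
    and u: "u \<in> carrier_vec d"
  show "p u = 0"
  proof (rule polynomial_function_zero_on_torus[OF p(1) _ u])
    fix w assume w: "w \<in> complex_torus d"
    have "\<exists>a. exp a = w $ i / l $ b i" if "i < d" for i
      using that w l b by (intro exists_complex_exp) (auto simp: complex_torus_def)
    then obtain y where y: "\<And>i. i < d \<Longrightarrow> exp (y i) = w $ i / l $ b i" by metis
    obtain x where x: "x \<in> complex_torus d" "\<And>j. j < n \<Longrightarrow> scaled_monomial_map l A x $ j =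
        l $ j * exp (\<Sum>i<d. of_rat ((G * map_mat rat_of_int A) $$ (i, j)) * y i)"
      using toric_point[OF A G] by blast
    have "scaled_monomial_map l A x $ b k = w $ k" if k: "k < d" for k
    proof -
      have "(\<Sum>i<d. of_rat ((G * map_mat rat_of_int A) $$ (i, b k)) * y i) = (\<Sum>i<d. if i = k then y i else 0)"
        using Gb k by (intro sum.cong) auto
      then show ?thesis using x(2)[OF b[OF k]] y[OF k] k l b[OF k] by (simp add: complex_torus_def)
    qed
    then have "vec d (\<lambda>k. scaled_monomial_map l A x $ b k) = w"
      using w by (auto simp: complex_torus_def)
    moreover have "scaled_monomial_map l A x \<in> toric_variety l A"
      using x(1) A subset_zariski_closure unfolding toric_variety_def by blast
    ultimately show "p w = 0" using p(2) by metis
  qed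
qed

section \<open>Counting characters and the upper bound for the dimension\<close>

definition character :: "nat \<Rightarrow> (nat \<Rightarrow> int) \<Rightarrow> (nat \<Rightarrow> complex) \<Rightarrow> complex" where
  "character d e z = exp (\<Sum>i<d. of_int (e i) * z i)"

text \<open>In the variables \<open>exp (z i)\<close> these are Laurent monomials. The size of the
  box is at most of order \<open>N\<close> to the power \<open>d\<close>, and this growth rate
  bounds the dimension.\<close>

definition character_box :: "nat \<Rightarrow> nat \<Rightarrow> ((nat \<Rightarrow> complex) \<Rightarrow> complex) set" where
  "character_box d N = character d ` PiE {..<d} (\<lambda>_. {- int N..int N})"

lemma character_cong: "(\<And>i. i < d \<Longrightarrow> e i = e' i) \<Longrightarrow> character d e = character d e'"
  by (auto simp: character_def fun_eq_iff intro!: arg_cong[where f = exp] sum.cong)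

lemma character_in_box:
  assumes "\<And>i. i < d \<Longrightarrow> \<bar>e i\<bar> \<le> int N"
  shows "character d e \<in> character_box d N"
proof -
  have "restrict e {..<d} \<in> PiE {..<d} (\<lambda>_. {- int N..int N})"
    using assms by (auto simp: abs_le_iff minus_le_iff)
  moreover have "character d e = character d (restrict e {..<d})"
    by (rule character_cong) simp
  ultimately show ?thesis unfolding character_box_def by blast
qed

lemma character_box_mult:
  assumes "f \<in> character_box d M" "g \<in> character_box d N"
  shows "(\<lambda>z. f z * g z) \<in> character_box d (M + N)"
proof -
  obtain e e' where e: "f = character d e" "e \<in> PiE {..<d} (\<lambda>_. {- int M..int M})"
    and e': "g = character d e'" "e' \<in> PiE {..<d} (\<lambda>_. {- int N..int N})"
    using assms unfolding character_box_def by auto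
  have "(\<lambda>z. f z * g z) = character d (\<lambda>i. e i + e' i)"
    by (simp add: e e' character_def fun_eq_iff exp_add sum.distrib distrib_right)
  moreover have "\<bar>e i + e' i\<bar> \<le> int (M + N)" if "i < d" for i
  proof -
    have "e i \<in> {- int M..int M}" "e' i \<in> {- int N..int N}"
      using PiE_mem[OF e(2), of i] PiE_mem[OF e'(2), of i] that by simp_all
    then show ?thesis by auto
  qed
  ultimately show ?thesis using character_in_box[of d "\<lambda>i. e i + e' i" "M + N"] by simp
qed

lemma finite_character_box: "finite (character_box d N)"
  unfolding character_box_def by (intro finite_imageI finite_PiE) auto

lemma card_character_box: "card (character_box d N) \<le> (2 * N + 1) ^ d"
proof -
  have "card (character_box d N) \<le> card (PiE {..<d} (\<lambda>_. {- int N..int N}))"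
    unfolding character_box_def by (intro card_image_le finite_PiE) auto
  also have "\<dots> = (2 * N + 1) ^ d"
    by (simp add: card_PiE nat_add_distrib nat_mult_distrib)
  finally show ?thesis .
qed

text \<open>What is used of this structure is that an independent set inside a finite span is no
  larger than the spanning set.\<close>

global_interpretation fun_space: vector_space "\<lambda>c (f :: 'a \<Rightarrow> complex) z. c * f z"
  by unfold_locales (auto simp: fun_eq_iff algebra_simps)

abbreviation "fun_span \<equiv> fun_space.span"

text \<open>By bilinearity: a span induction on \<open>g\<close> for fixed \<open>u\<close> in
  \<open>S\<close>, followed by one on \<open>f\<close>.\<close>

lemma span_mult:
  assumes f: "f \<in> fun_span S" and g: "g \<in> fun_span T"
    and ST: "\<And>u v. u \<in> S \<Longrightarrow> v \<in> T \<Longrightarrow> (\<lambda>z. u z * v z) \<in> fun_span U"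
  shows "(\<lambda>z. f z * g z) \<in> fun_span U"
proof -
  have ug: "(\<lambda>z. u z * g z) \<in> fun_span U" if u: "u \<in> S" for u
    using g
  proof (induction rule: fun_space.span_induct_alt)
    case base
    then show ?case using fun_space.span_zero by (simp add: zero_fun_def)
  next
    case (step c v h)
    have "(\<lambda>z. c * (u z * v z)) + (\<lambda>z. u z * h z) \<in> fun_span U"
      using step ST[OF u] by (intro fun_space.span_add fun_space.span_scale)
    moreover have "(\<lambda>z. c * (u z * v z)) + (\<lambda>z. u z * h z) = (\<lambda>z. u z * ((\<lambda>z. c * v z) + h) z)"
      by (auto simp: fun_eq_iff algebra_simps)
    ultimately show ?case by simp
  qed
  show ?thesis
    using f
  proof (induction rule: fun_space.span_induct_alt)
    case base
    then show ?case using fun_space.span_zero by (simp add: zero_fun_def)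
  next
    case (step c v h)
    have "(\<lambda>z. c * (v z * g z)) + (\<lambda>z. h z * g z) \<in> fun_span U"
      using step ug by (intro fun_space.span_add fun_space.span_scale)
    moreover have "(\<lambda>z. c * (v z * g z)) + (\<lambda>z. h z * g z) = (\<lambda>z. ((\<lambda>z. c * v z) + h) z * g z)"
      by (auto simp: fun_eq_iff algebra_simps)
    ultimately show ?case by simp
  qed
qed

lemma span_box_mult:
  "f \<in> fun_span (character_box d M) \<Longrightarrow> g \<in> fun_span (character_box d N) \<Longrightarrow>
    (\<lambda>z. f z * g z) \<in> fun_span (character_box d (M + N))"
  by (rule span_mult) (auto intro: fun_space.span_base character_box_mult)

lemma character_box_mono: "M \<le> N \<Longrightarrow> character_box d M \<subseteq> character_box d N"
  unfolding character_box_def by (intro image_mono PiE_mono) auto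

lemma span_box_mono: "M \<le> N \<Longrightarrow> fun_span (character_box d M) \<subseteq> fun_span (character_box d N)"
  by (intro fun_space.span_mono character_box_mono)

lemma span_box_const: "(\<lambda>_. a) \<in> fun_span (character_box d N)"
proof -
  have "character d (\<lambda>_. 0) \<in> character_box d N" by (rule character_in_box) simp
  then have "(\<lambda>z. a * character d (\<lambda>_. 0) z) \<in> fun_span (character_box d N)"
    by (intro fun_space.span_scale fun_space.span_base)
  then show ?thesis by (simp add: character_def)
qed

lemma span_box_power:
  assumes "f \<in> fun_span (character_box d M)"
  shows "(\<lambda>z. f z ^ m) \<in> fun_span (character_box d (M * m))"
proof (induction m)
  case (Suc m)
  then show ?case using span_box_mult[OF assms Suc] by simp
qed (simp add: span_box_const)

lemma span_box_prod:
  assumes "\<And>j. j < (k :: nat) \<Longrightarrow> f j \<in> fun_span (character_box d M)"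
  shows "(\<lambda>z. \<Prod>j<k. f j z) \<in> fun_span (character_box d (k * M))"
  using assms
proof (induction k)
  case (Suc k)
  then have "(\<lambda>z. (\<Prod>j<k. f j z) * f k z) \<in> fun_span (character_box d (k * M + M))"
    by (intro span_box_mult) auto
  then show ?case by (simp add: add.commute)
qed (simp add: span_box_const)

lemma polynomial_function_span_box:
  assumes A: "A \<in> carrier_mat d n" and f: "f \<in> polynomial_functions n"
  shows "\<exists>N. (\<lambda>z. f (scaled_monomial_map l A (vec d (\<lambda>i. exp (z i))))) \<in> fun_span (character_box d N)"
  using f
proof (induction rule: polynomial_functions.induct)
  case (const a)
  show ?case by (intro exI[of _ 0] span_box_const)
next
  case (coord j)
  define N where "N = Max ((\<lambda>i. nat \<bar>A $$ (i, j)\<bar>) ` {..<d})"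
  have "nat \<bar>A $$ (i, j)\<bar> \<le> N" if "i < d" for i
    using that by (auto simp: N_def)
  then have "\<bar>A $$ (i, j)\<bar> \<le> int N" if "i < d" for i
    using that by (simp add: nat_le_iff)
  then have "character d (\<lambda>i. A $$ (i, j)) \<in> character_box d N" by (rule character_in_box)
  then have "(\<lambda>z. l $ j * character d (\<lambda>i. A $$ (i, j)) z) \<in> fun_span (character_box d N)"
    by (intro fun_space.span_scale fun_space.span_base)
  then show ?case
    using scaled_monomial_map_exp[OF A coord] by (auto simp: character_def)
next
  case (add f g)
  then obtain M N where M: "(\<lambda>z. f (scaled_monomial_map l A (vec d (\<lambda>i. exp (z i))))) \<in> fun_span (character_box d M)"
    and N: "(\<lambda>z. g (scaled_monomial_map l A (vec d (\<lambda>i. exp (z i))))) \<in> fun_span (character_box d N)"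
    by blast
  show ?case
    using fun_space.span_add[of _ "character_box d (M + N)"]
      M N span_box_mono[of M "M + N" d] span_box_mono[of N "M + N" d]
    by (intro exI[of _ "M + N"]) (auto simp: plus_fun_def)
next
  case (mult f g)
  then show ?case using span_box_mult by blast
qed

lemma sum_fun_apply: "(\<Sum>a\<in>A. f a) x = (\<Sum>a\<in>A. f a x)"
  for f :: "'a \<Rightarrow> 'b \<Rightarrow> 'c :: comm_monoid_add"
  by (induction A rule: infinite_finite_induct) auto

text \<open>Dependence is a property of sets, while \<open>h\<close> is a family. If
  \<open>h\<close> is injective on \<open>I\<close>, its image is too large to be independent;
  otherwise two equal members give a relation with coefficients 1 and -1.\<close>

lemma exists_linear_relation:
  assumes T: "finite T" and I: "finite I" "card T < card I" and h: "\<And>m. m \<in> I \<Longrightarrow> h m \<in> fun_span T"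
  shows "\<exists>c. (\<exists>m\<in>I. c m \<noteq> 0) \<and> (\<forall>z. (\<Sum>m\<in>I. c m * h m z) = 0)"
proof (cases "inj_on h I")
  case True
  have "fun_space.dependent (h ` I)"
    using fun_space.independent_span_bound[OF T, of "h ` I"] h I card_image[OF True] by auto
  then obtain u where u: "\<exists>v\<in>h ` I. u v \<noteq> 0" "(\<Sum>v\<in>h ` I. (\<lambda>z. u v * v z)) = 0"
    using fun_space.dependent_finite[of "h ` I"] I(1) by auto
  have "(\<Sum>m\<in>I. u (h m) * h m z) = 0" for z
  proof -
    have "(\<Sum>m\<in>I. u (h m) * h m z) = (\<Sum>v\<in>h ` I. (\<lambda>z. u v * v z)) z"
      using True by (simp add: sum.reindex sum_fun_apply)
    then show ?thesis using u(2) by simp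
  qed
  then show ?thesis using u(1) by (intro exI[of _ "\<lambda>m. u (h m)"]) auto
next
  case False
  then obtain a b where ab: "a \<in> I" "b \<in> I" "a \<noteq> b" "h a = h b" by (auto simp: inj_on_def)
  define c where "c m = (if m = a then 1 else if m = b then -1 else 0 :: complex)" for m
  have "(\<Sum>m\<in>I. c m * h m z) = 0" for z
  proof -
    have "(\<Sum>m\<in>I. c m * h m z) = c a * h a z + (c b * h b z + (\<Sum>m\<in>I - {a} - {b}. c m * h m z))"
      using ab I(1) by (simp add: sum.remove[of I a] sum.remove[of "I - {a}" b])
    also have "(\<Sum>m\<in>I - {a} - {b}. c m * h m z) = 0" by (intro sum.neutral) (auto simp: c_def)
    finally show ?thesis using ab by (simp add: c_def)
  qed
  moreover have "c a \<noteq> 0" by (simp add: c_def)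
  ultimately show ?thesis using ab(1) by blast
qed

lemma sum_digits:
  fixes K :: nat
  shows "(\<Sum>j<k. (m div K ^ j mod K) * K ^ j) = m mod K ^ k"
proof (induction k)
  case (Suc k)
  have "m mod K ^ Suc k = K ^ k * (m div K ^ k mod K) + m mod K ^ k"
    using mod_mult2_eq[of m "K ^ k" K] by (simp add: mult.commute)
  then show ?case using Suc by (simp add: mult.commute)
qed simp

text \<open>
  The monomials with exponents less than \<open>K\<close> are indexed by \<open>m < K ^ k\<close> through the base \<open>K\<close>
  digits, so that the substitution \<open>y j = t ^ K ^ j\<close> turns them into distinct powers of \<open>t\<close>.
\<close>

lemma toric_variety_dim_le:
  assumes A: "A \<in> carrier_mat d n" and fs: "\<And>j. j < k \<Longrightarrow> fs j \<in> polynomial_functions n"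
    and indep: "algebraically_independent_on (toric_variety l A) k fs"
  shows "k \<le> d"
proof (rule ccontr)
  assume "\<not> k \<le> d"
  then have dk: "Suc d \<le> k" by simp
  define F where "F j z = fs j (scaled_monomial_map l A (vec d (\<lambda>i. exp (z i))))" for j z
  have "\<exists>N. \<forall>j<k. F j \<in> fun_span (character_box d N)"
  proof -
    have "\<exists>N. F j \<in> fun_span (character_box d N)" if "j < k" for j
      using polynomial_function_span_box[OF A fs[OF that]] by (simp add: F_def[abs_def])
    then obtain N where N: "\<And>j. j < k \<Longrightarrow> F j \<in> fun_span (character_box d (N j))" by metis
    have "F j \<in> fun_span (character_box d (Max (N ` {..<k})))" if "j < k" for j
      using N[OF that] span_box_mono[of "N j" "Max (N ` {..<k})" d] that by auto
    then show ?thesis by blast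
  qed
  then obtain M where M: "\<And>j. j < k \<Longrightarrow> F j \<in> fun_span (character_box d M)" by blast
  \<comment> \<open>There are \<open>K ^ k\<close> monomials in the \<open>F j\<close> with
    exponents below \<open>K\<close>, and they lie in the span of at most
    \<open>(2 * (k * M) + 1) ^ d * K ^ d\<close> characters. As \<open>K\<close> exceeds the
    constant factor and \<open>k > d\<close>, there are more monomials than characters.\<close>
  define K where "K = Suc ((2 * (k * M) + 1) ^ d)"
  define dig where "dig m j = m div K ^ j mod K" for m j
  define h where "h m z = (\<Prod>j<k. F j z ^ dig m j)" for m z
  define T where "T = character_box d (k * (M * K))"
  have K0: "K > 0" by (simp add: K_def)
  have "h m \<in> fun_span T" for m
    unfolding h_def[abs_def] T_def
  proof (rule span_box_prod)
    fix j assume "j < k"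
    have "dig m j \<le> K" using K0 by (simp add: dig_def less_imp_le)
    then show "(\<lambda>z. F j z ^ dig m j) \<in> fun_span (character_box d (M * K))"
      using span_box_power[OF M[OF \<open>j < k\<close>], of "dig m j"] span_box_mono[of "M * dig m j" "M * K" d]
      by auto
  qed
  moreover have "card T < card {..<K ^ k}"
  proof -
    have "card T \<le> (2 * (k * (M * K)) + 1) ^ d" unfolding T_def by (rule card_character_box)
    also have "\<dots> \<le> ((2 * (k * M) + 1) * K) ^ d"
      using K0 by (intro power_mono) (auto simp: algebra_simps)
    also have "\<dots> = (2 * (k * M) + 1) ^ d * K ^ d" by (rule power_mult_distrib)
    also have "\<dots> < K * K ^ d" using K0 by (intro mult_strict_right_mono) (auto simp: K_def)
    also have "\<dots> = K ^ Suc d" by simp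
    also have "\<dots> \<le> K ^ k" using K0 dk by (intro power_increasing) auto
    finally show ?thesis by simp
  qed
  ultimately obtain c where c: "\<exists>m<K ^ k. c m \<noteq> 0" "\<And>z. (\<Sum>m<K ^ k. c m * h m z) = 0"
    using exists_linear_relation[of T "{..<K ^ k}" h] finite_character_box unfolding T_def by auto
  define p where "p y = (\<Sum>m<K ^ k. c m * (\<Prod>j<k. (y $ j) ^ dig m j))" for y
  have p: "p \<in> polynomial_functions k"
    unfolding p_def[abs_def]
    by (intro polynomial_functions_sum polynomial_functions_prod polynomial_functions_power
        polynomial_functions.intros) auto
  \<comment> \<open>The composition of \<open>p\<close> with the functions \<open>fs j\<close>. It
    vanishes on the image of the torus by the linear relation, hence on the closure.\<close>
  define r where "r x = (\<Sum>m<K ^ k. c m * (\<Prod>j<k. fs j x ^ dig m j))" for x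
  have r: "r \<in> polynomial_functions n"
    unfolding r_def[abs_def]
    by (intro polynomial_functions_sum polynomial_functions_prod polynomial_functions_power
        polynomial_functions.mult polynomial_functions.const fs) auto
  have "r s = 0" if s: "s \<in> scaled_monomial_map l A ` complex_torus d" for s
  proof -
    obtain x where x: "s = scaled_monomial_map l A x" "x \<in> complex_torus d" using s by auto
    have "\<exists>a. exp a = x $ i" if "i < d" for i
      using that x by (intro exists_complex_exp) (auto simp: complex_torus_def)
    then obtain z where "\<And>i. i < d \<Longrightarrow> exp (z i) = x $ i" by metis
    then have "x = vec d (\<lambda>i. exp (z i))" using x by (auto simp: complex_torus_def)
    then show ?thesis using c(2)[of z] by (simp add: r_def h_def F_def x)
  qed
  moreover have "scaled_monomial_map l A ` complex_torus d \<subseteq> carrier_vec n"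
    using A by (auto simp: scaled_monomial_map_def)
  ultimately have "r x = 0" if "x \<in> toric_variety l A" for x
    using that r A unfolding toric_variety_def by (auto simp: zariski_closure_eq)
  then have "\<forall>x\<in>toric_variety l A. p (vec k (\<lambda>j. fs j x)) = 0"
    by (simp add: p_def r_def)
  then have zero: "p y = 0" if "y \<in> carrier_vec k" for y
    using indep p that unfolding algebraically_independent_on_def by blast
  have "(\<Sum>m<K ^ k. c m * t ^ m) = 0" for t
  proof -
    have "(\<Prod>j<k. (t ^ K ^ j) ^ dig m j) = t ^ m" if "m < K ^ k" for m
    proof -
      have "(\<Prod>j<k. (t ^ K ^ j) ^ dig m j) = t ^ (\<Sum>j<k. dig m j * K ^ j)"
        by (simp add: power_sum power_mult[symmetric] mult.commute)
      then show ?thesis using sum_digits[of m K k] that by (simp add: dig_def)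
    qed
    then have "p (vec k (\<lambda>j. t ^ K ^ j)) = (\<Sum>m<K ^ k. c m * t ^ m)"
      unfolding p_def by (intro sum.cong) auto
    then show ?thesis using zero[of "vec k (\<lambda>j. t ^ K ^ j)"] by simp
  qed
  then have "poly (\<Sum>m<K ^ k. monom (c m) m) t = 0" for t
    by (simp add: poly_sum poly_monom)
  then have "(\<Sum>m<K ^ k. monom (c m) m) = 0" using poly_all_0_iff_0 by blast
  moreover have "coeff (\<Sum>m<K ^ k. monom (c m) m) m = c m" if "m < K ^ k" for m
    using that by (simp add: coeff_sum sum.delta)
  ultimately have "c m = 0" if "m < K ^ k" for m
    using that by (metis coeff_0)
  then show False using c(1) by blast
qed

section \<open>Sign variation and the positive Grassmannian\<close>

text \<open>This is the index shift of \<open>mat_delete\<close>, so that deleting a column of a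
  submatrix amounts to removing an element of \<open>J\<close>. The proof counts the elements of the
  reduced set below the claimed one.\<close>

lemma pick_remove_pick:
  assumes J: "finite J" and k: "k < card J" and l: "l < card J - 1"
  shows "pick (J - {pick J k}) l = pick J (if l < k then l else Suc l)"
proof -
  let ?p = "pick J k" and ?m = "if l < k then l else Suc l"
  have m: "?m < card J" "?m \<noteq> k" using k l by auto
  have mono: "pick J x < pick J y \<longleftrightarrow> x < y" if "x < card J" "y < card J" for x y
    using that pick_mono_le[of x J y] pick_mono_le[of y J x]
    by (cases x y rule: linorder_cases) auto
  have inJ: "pick J ?m \<in> J" using m by (intro pick_in_set_le)
  have ne: "pick J ?m \<noteq> ?p"
    using mono[of ?m k] mono[of k ?m] m k by (cases ?m k rule: linorder_cases) (auto simp del: if_split)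
  have card: "card {a\<in>J. a < pick J ?m} = ?m" using m(1) by (intro card_pick) auto
  have "card {a\<in>J - {?p}. a < pick J ?m} = l"
  proof (cases "l < k")
    case True
    then have "\<not> ?p < pick J ?m" using mono m k by simp
    then have "{a\<in>J - {?p}. a < pick J ?m} = {a\<in>J. a < pick J ?m}" using ne by auto
    then show ?thesis using card True by simp
  next
    case False
    then have "k < ?m" by simp
    then have "?p < pick J ?m" using mono[OF k m(1)] by blast
    moreover have "?p \<in> J" using k by (intro pick_in_set_le)
    ultimately have "{a\<in>J. a < pick J ?m} = insert ?p {a\<in>J - {?p}. a < pick J ?m}" by auto
    moreover have "finite {a\<in>J - {?p}. a < pick J ?m}" using J by simp
    ultimately show ?thesis using card False by simp
  qed
  then show ?thesis using pick_card_in_set[of "pick J ?m" "J - {?p}"] inJ ne by auto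
qed

lemma submatrix_UNIV_index:
  assumes "M \<in> carrier_mat c n" "J \<subseteq> {..<n}" "i < c" "k < card J"
  shows "submatrix M UNIV J $$ (i, k) = M $$ (i, pick J k)"
proof -
  have "{j. j < n \<and> j \<in> J} = J" using assms by auto
  then show ?thesis using assms by (subst submatrix_index) (auto simp: pick_UNIV)
qed

lemma submatrix_UNIV_carrier:
  assumes "M \<in> carrier_mat c n" "J \<subseteq> {..<n}"
  shows "submatrix M UNIV J \<in> carrier_mat c (card J)"
proof -
  have "{j. j < n \<and> j \<in> J} = J" using assms by auto
  then show ?thesis using assms by (auto simp: dim_submatrix)
qed

text \<open>
  With \<open>v\<close> stacked on top of \<open>M\<close>, the square submatrix on the columns \<open>J\<close> is singular, and the
  terms of its Laplace expansion along the row \<open>v\<close> all have the same weak sign.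
\<close>

lemma positive_grassmannian_weakly_alternating_eq_0:
  assumes L: "L \<in> positive_grassmannian c n" and v: "v \<in> L"
    and J: "J \<subseteq> {..<n}" "card J = Suc c"
    and \<eta>: "\<eta> \<noteq> 0" and alt: "\<And>j. j \<in> J \<Longrightarrow> \<eta> * v $ j * (-1) ^ card {i\<in>J. i < j} \<ge> 0"
  shows "v = 0\<^sub>v n"
proof -
  obtain M where M: "M \<in> carrier_mat c n" and LM: "L = vec_space.row_space n M"
    and pos: "\<And>J. J \<subseteq> {..<n} \<Longrightarrow> card J = c \<Longrightarrow> det (submatrix M UNIV J) > 0"
    using L unfolding positive_grassmannian_def by auto
  interpret vec_space "TYPE(real)" n .
  obtain y where y: "y \<in> carrier_vec c" "v = M\<^sup>T *\<^sub>v y"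
    using v M unfolding LM row_space_eq[OF M] by auto
  have vj: "v $ j = (\<Sum>i<c. y $ i * M $$ (i, j))" if "j < n" for j
    using that M y by (simp add: scalar_prod_def lessThan_atLeast0 mult.commute)
  have fJ: "finite J" using J finite_subset by blast
  have pJ: "pick J k < n" "pick J k \<in> J" if "k < Suc c" for k
    using J pick_in_set_le[of k J] that by auto
  define N where "N = mat (Suc c) (Suc c)
    (\<lambda>(i, k). case i of 0 \<Rightarrow> v $ pick J k | Suc i' \<Rightarrow> M $$ (i', pick J k))"
  have N: "N \<in> carrier_mat (Suc c) (Suc c)" by (simp add: N_def)
  \<comment> \<open>Deleting the row of \<open>v\<close> and one column leaves a maximal minor of
    \<open>M\<close>.\<close>
  have del: "det (mat_delete N 0 k) > 0" if k: "k < Suc c" for k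
  proof -
    have sub: "J - {pick J k} \<subseteq> {..<n}" and cd: "card (J - {pick J k}) = c"
      using J pJ[OF k] by auto
    have "mat_delete N 0 k = submatrix M UNIV (J - {pick J k})"
    proof (rule eq_matI)
      have cc: "submatrix M UNIV (J - {pick J k}) \<in> carrier_mat c c"
        using submatrix_UNIV_carrier[OF M sub] cd by simp
      show "dim_row (mat_delete N 0 k) = dim_row (submatrix M UNIV (J - {pick J k}))"
        "dim_col (mat_delete N 0 k) = dim_col (submatrix M UNIV (J - {pick J k}))"
        using N cc by (auto simp: mat_delete_def)
      fix i l assume "i < dim_row (submatrix M UNIV (J - {pick J k}))"
        "l < dim_col (submatrix M UNIV (J - {pick J k}))"
      then have il: "i < c" "l < c" using cc by auto
      have "mat_delete N 0 k $$ (i, l) = M $$ (i, pick J (if l < k then l else Suc l))"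
        using il N by (auto simp: mat_delete_def N_def)
      also have "\<dots> = M $$ (i, pick (J - {pick J k}) l)"
        using pick_remove_pick[OF fJ, of k l] k il J by simp
      also have "\<dots> = submatrix M UNIV (J - {pick J k}) $$ (i, l)"
        using submatrix_UNIV_index[OF M sub] il cd by simp
      finally show "mat_delete N 0 k $$ (i, l) = submatrix M UNIV (J - {pick J k}) $$ (i, l)" .
    qed
    then show ?thesis using pos[OF sub cd] by simp
  qed
  have detN: "det N = 0"
  proof -
    \<comment> \<open>The vector with entries -1 and \<open>y\<close> records that the top row
      \<open>v\<close> is the combination of the rows of \<open>M\<close> with coefficients
      \<open>y\<close>.\<close>
    define z where "z = vec (Suc c) (\<lambda>i. case i of 0 \<Rightarrow> -1 | Suc i' \<Rightarrow> y $ i')"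
    have z: "z \<in> carrier_vec (Suc c)" "z \<noteq> 0\<^sub>v (Suc c)"
      by (auto simp: z_def vec_eq_iff intro!: exI[of _ 0])
    have "N\<^sup>T *\<^sub>v z = 0\<^sub>v (Suc c)"
    proof (rule eq_vecI)
      fix k assume "k < dim_vec (0\<^sub>v (Suc c) :: real vec)"
      then have k: "k < Suc c" by simp
      have "(N\<^sup>T *\<^sub>v z) $ k = (\<Sum>i<Suc c. N $$ (i, k) * z $ i)"
        using k N z by (simp add: scalar_prod_def lessThan_atLeast0)
      also have "\<dots> = - v $ pick J k + (\<Sum>i<c. M $$ (i, pick J k) * y $ i)"
        using k by (simp add: sum.lessThan_Suc_shift N_def z_def del: sum.lessThan_Suc)
      also have "\<dots> = 0" using vj[OF pJ(1)[OF k]] by (simp add: mult.commute)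
      finally show "(N\<^sup>T *\<^sub>v z) $ k = 0\<^sub>v (Suc c) $ k" using k by simp
    qed (use N in auto)
    then have "det (N\<^sup>T) = 0"
      using det_0_iff_vec_prod_zero_field[of "N\<^sup>T" "Suc c"] N z by auto
    then show ?thesis using det_transpose[OF N] by simp
  qed
  have tm: "\<eta> * (N $$ (0, k) * cofactor N 0 k) \<ge> 0"
    "\<eta> * (N $$ (0, k) * cofactor N 0 k) = 0 \<longleftrightarrow> v $ pick J k = 0" if k: "k < Suc c" for k
  proof -
    have "card {i\<in>J. i < pick J k} = k" using k J by (intro card_pick) auto
    then have e: "\<eta> * (N $$ (0, k) * cofactor N 0 k) =
      (\<eta> * v $ pick J k * (-1) ^ card {i\<in>J. i < pick J k}) * det (mat_delete N 0 k)"
      using k by (simp add: cofactor_def N_def)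
    show "\<eta> * (N $$ (0, k) * cofactor N 0 k) \<ge> 0"
      unfolding e by (rule mult_nonneg_nonneg[OF alt[OF pJ(2)[OF k]] less_imp_le[OF del[OF k]]])
    show "\<eta> * (N $$ (0, k) * cofactor N 0 k) = 0 \<longleftrightarrow> v $ pick J k = 0"
      unfolding e using del[OF k] \<eta> by auto
  qed
  \<comment> \<open>The terms are nonnegative and add up to \<open>\<eta> * det N = 0\<close>, so
    each of them vanishes, and with it each entry of \<open>v\<close> on \<open>J\<close>.\<close>
  have "(\<Sum>k<Suc c. \<eta> * (N $$ (0, k) * cofactor N 0 k)) = \<eta> * det N"
    using laplace_expansion_row[OF N, of 0] by (simp add: sum_distrib_left del: sum.lessThan_Suc)
  then have "\<forall>k\<in>{..<Suc c}. \<eta> * (N $$ (0, k) * cofactor N 0 k) = 0"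
    using detN tm(1)
      sum_nonneg_eq_0_iff[of "{..<Suc c}" "\<lambda>k. \<eta> * (N $$ (0, k) * cofactor N 0 k)"] by force
  then have v0: "v $ pick J k = 0" if "k < Suc c" for k using tm(2) that by auto
  \<comment> \<open>Any \<open>c\<close> of these zeros suffice: the minor of \<open>M\<close> on
    \<open>J'\<close> is nonzero, which forces \<open>y\<close> and hence \<open>v\<close> to
    vanish.\<close>
  define J' where "J' = J - {pick J 0}"
  have J': "J' \<subseteq> {..<n}" "card J' = c" using J pJ[of 0] unfolding J'_def by auto
  define S where "S = submatrix M UNIV J'"
  have S: "S \<in> carrier_mat c c" using submatrix_UNIV_carrier[OF M J'(1)] J' by (simp add: S_def)
  have "S\<^sup>T *\<^sub>v y = 0\<^sub>v c"
  proof (rule eq_vecI)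
    fix k assume "k < dim_vec (0\<^sub>v c :: real vec)"
    then have k: "k < c" by simp
    have "pick J' k = pick J (Suc k)" using pick_remove_pick[OF fJ, of 0 k] k J by (simp add: J'_def)
    then have "(S\<^sup>T *\<^sub>v y) $ k = (\<Sum>i<c. y $ i * M $$ (i, pick J (Suc k)))"
      using k S y submatrix_UNIV_index[OF M J'(1)] J'
      by (simp add: scalar_prod_def lessThan_atLeast0 mult.commute S_def)
    also have "\<dots> = 0" using vj[of "pick J (Suc k)"] v0[of "Suc k"] pJ[of "Suc k"] k by simp
    finally show "(S\<^sup>T *\<^sub>v y) $ k = 0\<^sub>v c $ k" using k by simp
  qed (use S in auto)
  moreover have "det (S\<^sup>T) \<noteq> 0" using pos[OF J'] det_transpose[OF S] by (simp add: S_def)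
  ultimately have "y = 0\<^sub>v c" using det_0_iff_vec_prod_zero_field[of "S\<^sup>T" c] S y by auto
  then show ?thesis using y M by (intro eq_vecI) (auto simp: scalar_prod_def)
qed

section \<open>Vandermonde matrices and members of the positive Grassmannian\<close>

lemma prod_list_pos:
  fixes xs :: "'a :: linordered_semidom list"
  shows "(\<And>x. x \<in> set xs \<Longrightarrow> x > 0) \<Longrightarrow> prod_list xs > 0"
  by (induction xs) auto

lemma poly_eq_sum_lessThan:
  fixes p :: "'a :: comm_semiring_1 poly"
  assumes "degree p < m"
  shows "poly p x = (\<Sum>i<m. coeff p i * x ^ i)"
  unfolding poly_altdef using assms
  by (intro sum.mono_neutral_left) (auto simp: coeff_eq_0)

lemma degree_prod_linear:
  fixes x :: "'b \<Rightarrow> 'a :: idom"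
  assumes "finite K"
  shows "degree (\<Prod>k\<in>K. [:x k, 1:]) = card K" "coeff (\<Prod>k\<in>K. [:x k, 1:]) (card K) = 1"
proof -
  show deg: "degree (\<Prod>k\<in>K. [:x k, 1:]) = card K"
    using assms by (simp add: degree_prod_sum_eq)
  show "coeff (\<Prod>k\<in>K. [:x k, 1:]) (card K) = 1"
    using lead_coeff_prod[of "\<lambda>k. [:x k, 1:]" K] by (simp add: deg)
qed

text \<open>
  Multiplying the Vandermonde matrix from the left by the unitriangular matrix of coefficients
  of the Newton polynomials \<open>\<Prod>l<i. (t - x l)\<close> makes it upper triangular.
\<close>

lemma det_vandermonde_pos:
  fixes x :: "nat \<Rightarrow> real"
  assumes mono: "\<And>i k. i < k \<Longrightarrow> k < c \<Longrightarrow> x i < x k"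
  shows "det (mat c c (\<lambda>(i, k). x k ^ i)) > 0"
proof -
  define q where "q i = (\<Prod>l<i. [:- x l, 1:])" for i :: nat
  define V where "V = mat c c (\<lambda>(i, k). x k ^ i)"
  define C where "C = mat c c (\<lambda>(i, m). coeff (q i) m)"
  have V: "V \<in> carrier_mat c c" and C: "C \<in> carrier_mat c c" by (simp_all add: V_def C_def)
  have q: "degree (q i) = i" "coeff (q i) i = 1" for i
    using degree_prod_linear[of "{..<i}" "\<lambda>l. - x l"] by (simp_all add: q_def)
  have pq: "poly (q i) y = (\<Prod>l<i. y - x l)" for i y
    by (simp add: q_def poly_prod)
  have CV: "(C * V) $$ (i, k) = poly (q i) (x k)" if "i < c" "k < c" for i k
    using that q poly_eq_sum_lessThan[of "q i" c "x k"]
    by (simp add: C_def V_def scalar_prod_def lessThan_atLeast0)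
  have "det C = prod_list (diag_mat C)"
    using q by (intro det_lower_triangular[OF _ C]) (auto simp: C_def coeff_eq_0)
  also have "diag_mat C = replicate c 1"
    using q by (auto simp: diag_mat_def C_def intro: nth_equalityI)
  finally have detC: "det C = 1" by simp
  have "upper_triangular (C * V)"
    unfolding upper_triangular_def
  proof (intro allI impI)
    fix i j assume i: "i < dim_row (C * V)" and ji: "j < i"
    then show "(C * V) $$ (i, j) = 0"
      using CV[of i j] C by (auto simp: pq)
  qed
  then have "det (C * V) = prod_list (diag_mat (C * V))"
    by (rule det_upper_triangular[OF _ mult_carrier_mat[OF C V]])
  also have "\<dots> > 0"
    using C by (intro prod_list_pos) (auto simp: diag_mat_def CV pq mono intro!: prod_pos)
  finally have "det C * det V > 0" using det_mult[OF C V] by simp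
  then show ?thesis using detC by (simp add: V_def)
qed

text \<open>A root displaced by less than 1 from \<open>k\<close> does not pass the integer
  \<open>x\<close>, so the sign of the product is given by the number of \<open>k\<close> above
  \<open>x\<close>.\<close>

lemma sign_prod_diff_near_nat:
  fixes z :: "nat \<Rightarrow> real"
  assumes "finite K" "\<And>k. k \<in> K \<Longrightarrow> k \<noteq> x" "\<And>k. k \<in> K \<Longrightarrow> \<bar>z k - real k\<bar> < 1"
  shows "(\<Prod>k\<in>K. real x - z k) * (-1) ^ card {k\<in>K. x < k} > 0"
  using assms
proof (induction K rule: finite_induct)
  case (insert a K)
  have a: "a \<noteq> x" "\<bar>z a - real a\<bar> < 1" and IH: "(\<Prod>k\<in>K. real x - z k) * (-1) ^ card {k\<in>K. x < k} > 0"
    using insert by auto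
  show ?case
  proof (cases "x < a")
    case True
    then have "{k\<in>insert a K. x < k} = insert a {k\<in>K. x < k}" by auto
    moreover have "real x - z a < 0" using True a by linarith
    ultimately show ?thesis
      using insert IH mult_pos_pos[OF IH, of "z a - real x"] by (simp add: algebra_simps)
  next
    case False
    then have "{k\<in>insert a K. x < k} = {k\<in>K. x < k}" by auto
    moreover have "real x - z a > 0" using False a by linarith
    ultimately show ?thesis
      using insert mult_pos_pos[OF IH, of "real x - z a"] by (simp add: algebra_simps)
  qed
qed simp

text \<open>
  Up to a positive rescaling of the coordinates, \<open>v\<close> is the vector of values at \<open>0, \<dots>, n - 1\<close>
  of a polynomial of degree less than \<open>n - d\<close>, with one root near every index outside \<open>J\<close>.
\<close>

lemma positive_grassmannian_memberI:
  assumes J: "J \<subseteq> {..<n}" "card J = Suc d" and v: "v \<in> carrier_vec n"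
    and alt: "\<And>j. j \<in> J \<Longrightarrow> \<eta> * v $ j * (-1) ^ (j + card {i\<in>J. i < j}) > 0"
  shows "\<exists>L \<in> positive_grassmannian (n - d) n. v \<in> L"
proof -
  define c where "c = n - d"
  define K where "K = {..<n} - J"
  have fJ: "finite J" using J(1) finite_subset by blast
  have "card J \<le> n" using card_mono[OF _ J(1)] by simp
  have K: "finite K" "card K < c" "K \<subseteq> {..<n}"
    using J fJ \<open>card J \<le> n\<close> by (auto simp: K_def c_def card_Diff_subset)
  obtain j0 where "j0 \<in> J" using J by fastforce
  then have \<eta>: "\<eta> \<noteq> 0" using alt by fastforce
  \<comment> \<open>The parity of \<open>n + d + 1\<close> makes \<open>e j\<close>, for
    \<open>j\<close> in \<open>J\<close>, equal to \<open>sgn \<eta>\<close> times the sign in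
    \<open>alt\<close>: the indices above \<open>j\<close> are divided between \<open>K\<close> and
    \<open>J\<close>, and \<open>J\<close> has \<open>d\<close> elements other than
    \<open>j\<close>.\<close>
  define \<kappa> where "\<kappa> = sgn \<eta> * (-1) ^ (n + d + 1)"
  define e where "e k = \<kappa> * (-1) ^ card {i\<in>K. k < i}" for k
  have e1: "\<bar>e k\<bar> = 1" for k using \<eta> by (simp add: e_def \<kappa>_def abs_mult abs_sgn_eq)
  \<comment> \<open>The root is moved from \<open>k\<close> by half a unit, to the side that gives
    \<open>p\<close> the sign of \<open>v $ k\<close> at \<open>k\<close>; for
    \<open>v $ k = 0\<close> it stays at \<open>k\<close>.\<close>
  define z where "z k = real k - sgn (v $ k) * e k / 2" for k
  have z: "\<bar>z k - real k\<bar> < 1" for k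
    using e1[of k] by (simp add: z_def abs_mult abs_sgn_eq)
  define p where "p = Polynomial.smult \<kappa> (\<Prod>k\<in>K. [:- z k, 1:])"
  have degp: "degree p < c"
    using degree_prod_linear[OF K(1), of "\<lambda>k. - z k"] K(2) by (simp add: p_def)
  have p: "poly p y = \<kappa> * (\<Prod>k\<in>K. y - z k)" for y by (simp add: p_def poly_prod)
  have e2: "e k * e k = 1" for k using e1[of k] by (metis abs_mult_self_eq mult_1)
  have sign: "\<exists>r>0. v $ j = r * poly p (real j)" if jn: "j < n" for j
  proof (cases "j \<in> J")
    case True
    define P where "P = (\<Prod>k\<in>K. real j - z k)"
    have P: "P * (-1) ^ card {k\<in>K. j < k} > 0"
      using sign_prod_diff_near_nat[OF K(1), of j z] True z unfolding P_def by (auto simp: K_def)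
    have "card {k\<in>K. j < k} + card {i\<in>J. j < i} = card ({k\<in>K. j < k} \<union> {i\<in>J. j < i})"
      using K fJ by (subst card_Un_disjoint) (auto simp: K_def)
    also have "{k\<in>K. j < k} \<union> {i\<in>J. j < i} = {j<..<n}" using J by (auto simp: K_def)
    finally have 1: "card {k\<in>K. j < k} + card {i\<in>J. j < i} + Suc j = n" using jn by simp
    have "J = insert j ({i\<in>J. i < j} \<union> {i\<in>J. j < i})" using True by auto
    moreover have "card (insert j ({i\<in>J. i < j} \<union> {i\<in>J. j < i})) =
        Suc (card {i\<in>J. i < j} + card {i\<in>J. j < i})"
      using fJ by (subst card_insert_disjoint) (auto simp: card_Un_disjoint disjoint_iff)
    ultimately have 2: "d = card {i\<in>J. i < j} + card {i\<in>J. j < i}" using J by simp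
    have 3: "n + d + 1 + card {k\<in>K. j < k} = (j + card {i\<in>J. i < j}) + 2 * (Suc (card {k\<in>K. j < k}) + card {i\<in>J. j < i})"
      by (subst 1[symmetric], subst 2) simp
    have "e j = sgn \<eta> * (-1) ^ (n + d + 1 + card {k\<in>K. j < k})"
      by (simp add: e_def \<kappa>_def power_add)
    also have "\<dots> = sgn \<eta> * (-1) ^ (j + card {i\<in>J. i < j})"
      unfolding 3 by (simp only: power_add power_mult) simp
    finally have ee: "e j = sgn \<eta> * (-1) ^ (j + card {i\<in>J. i < j})" .
    have pj: "poly p (real j) = e j * (P * (-1) ^ card {k\<in>K. j < k})"
      by (simp add: p P_def e_def)
    have "\<eta> * v $ j * (-1) ^ (j + card {i\<in>J. i < j}) = \<bar>\<eta>\<bar> * (e j * v $ j)"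
      using mult_sgn_abs[of \<eta>] unfolding ee by (simp add: mult.assoc mult.left_commute mult.commute)
    with alt[OF True] have "0 < \<bar>\<eta>\<bar> * (e j * v $ j)" by (simp only:)
    then have vj: "e j * v $ j > 0" using \<eta> by (simp add: zero_less_mult_iff)
    define Q where "Q = P * (-1) ^ card {k\<in>K. j < k}"
    have "v $ j = ((e j * v $ j) / Q) * poly p (real j)"
      using P e2[of j] unfolding pj Q_def[symmetric] by simp
    moreover have "(e j * v $ j) / Q > 0" using vj P by (simp add: Q_def)
    ultimately show ?thesis by blast
  next
    case False
    then have jK: "j \<in> K" using jn by (simp add: K_def)
    define P where "P = (\<Prod>k\<in>K - {j}. real j - z k)"
    have "{k\<in>K - {j}. j < k} = {k\<in>K. j < k}" by auto
    then have P: "P * (-1) ^ card {k\<in>K. j < k} > 0"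
      using sign_prod_diff_near_nat[of "K - {j}" j z] K z unfolding P_def by auto
    define Q where "Q = P * (-1) ^ card {k\<in>K. j < k}"
    have "poly p (real j) = \<kappa> * ((real j - z j) * P)"
      using K jK by (simp add: p P_def prod.remove)
    also have "\<dots> = e j * e j * (sgn (v $ j) / 2) * Q"
      by (simp add: z_def e_def Q_def)
    finally have pj: "poly p (real j) = sgn (v $ j) / 2 * Q" using e2 by simp
    show ?thesis
    proof (cases "v $ j = 0")
      case True
      then show ?thesis using pj by (intro exI[of _ 1]) simp
    next
      case False
      have Q: "Q > 0" using P by (simp add: Q_def)
      have "v $ j = (2 * \<bar>v $ j\<bar> / Q) * poly p (real j)"
        using Q unfolding pj by (simp add: abs_mult_sgn)
      moreover have "2 * \<bar>v $ j\<bar> / Q > 0" using Q False by simp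
      ultimately show ?thesis by blast
    qed
  qed
  then obtain r where r: "\<And>j. j < n \<Longrightarrow> r j > 0 \<and> v $ j = r j * poly p (real j)" by metis
  \<comment> \<open>The row space consists of the value vectors of polynomials of degree less than
    \<open>c\<close>, rescaled by \<open>r\<close>. Its maximal minors are Vandermonde determinants
    times products of the positive \<open>r j\<close>.\<close>
  define M where "M = mat c n (\<lambda>(i, j). real j ^ i * r j)"
  have M: "M \<in> carrier_mat c n" by (simp add: M_def)
  interpret vec_space "TYPE(real)" n .
  have "row_space M \<in> positive_grassmannian c n"
    unfolding positive_grassmannian_def
  proof (intro CollectI exI[of _ M] conjI refl M allI impI)
    fix I assume I: "I \<subseteq> {..<n} \<and> card I = c"
    define V where "V = mat c c (\<lambda>(i, k). real (pick I k) ^ i)"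
    define D where "D = mat c c (\<lambda>(i, k). if i = k then r (pick I k) else 0)"
    have VD: "V \<in> carrier_mat c c" "D \<in> carrier_mat c c" by (simp_all add: V_def D_def)
    have pI: "pick I k < n" if "k < c" for k
      using I pick_in_set_le[of k I] that by auto
    have "submatrix M UNIV I = V * D"
    proof (rule eq_matI)
      show "dim_row (submatrix M UNIV I) = dim_row (V * D)" "dim_col (submatrix M UNIV I) = dim_col (V * D)"
        using submatrix_UNIV_carrier[OF M, of I] I VD by auto
      fix i k assume "i < dim_row (V * D)" "k < dim_col (V * D)"
      then have ik: "i < c" "k < c" using VD by auto
      then have "(V * D) $$ (i, k) = real (pick I k) ^ i * r (pick I k)"
        by (simp add: V_def D_def scalar_prod_def sum.delta if_distrib cong: if_cong)
      moreover have "submatrix M UNIV I $$ (i, k) = M $$ (i, pick I k)"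
        using submatrix_UNIV_index[OF M] I ik by simp
      ultimately show "submatrix M UNIV I $$ (i, k) = (V * D) $$ (i, k)"
        using ik pI by (simp add: M_def)
    qed
    moreover have "det V > 0"
      unfolding V_def using I by (intro det_vandermonde_pos) (simp add: pick_mono_le)
    moreover have "det D > 0"
    proof -
      have "det D = prod_list (diag_mat D)"
        by (intro det_lower_triangular[OF _ VD(2)]) (auto simp: D_def)
      also have "\<dots> > 0" using VD r pI by (intro prod_list_pos) (auto simp: diag_mat_def D_def)
      finally show ?thesis .
    qed
    ultimately show "det (submatrix M UNIV I) > 0" using det_mult[OF VD] by simp
  qed
  moreover have "v \<in> row_space M"
  proof -
    define y where "y = vec c (coeff p)"
    have "M\<^sup>T *\<^sub>v y = v"
    proof (rule eq_vecI)
      fix j assume "j < dim_vec v"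
      then have j: "j < n" using v by simp
      have "(M\<^sup>T *\<^sub>v y) $ j = (\<Sum>i<c. real j ^ i * r j * coeff p i)"
        using j M by (simp add: y_def scalar_prod_def lessThan_atLeast0 M_def)
      also have "\<dots> = r j * poly p (real j)"
        unfolding poly_eq_sum_lessThan[OF degp] by (simp add: sum_distrib_left mult_ac)
      finally show "(M\<^sup>T *\<^sub>v y) $ j = v $ j" using r[OF j] by simp
    qed (use v M in auto)
    then show ?thesis using M v unfolding row_space_eq[OF M] by (auto simp: y_def)
  qed
  ultimately show ?thesis unfolding c_def by blast
qed

section \<open>Sign patterns of non-crossing partitions\<close>

lemma noncrossingD:
  assumes "noncrossing_partial_partition n d S" "i < d" "k < d" "i \<noteq> k"
    "a \<in> S i" "b \<in> S k" "c \<in> S i" "e \<in> S k" "a < b" "b < c" "c < e"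
  shows False
  using assms unfolding noncrossing_partial_partition_def cyclic_order4_def by blast

lemma neg_one_power_card:
  assumes "finite A"
  shows "(-1 :: 'a :: comm_ring_1) ^ card {i\<in>A. P i} = (\<Prod>i\<in>A. if P i then -1 else 1)"
proof -
  have "A \<inter> {i. P i} = {i\<in>A. P i}" by auto
  then show ?thesis using assms by (simp add: prod.If_cases)
qed

text \<open>A block with one element inside the interval spanned by \<open>S i\<close> and another
  outside would cross \<open>S i\<close>. Hence the least element decides for the whole
  block.\<close>

lemma noncrossing_hull:
  assumes nc: "noncrossing_partial_partition n d S" and ne: "\<And>i. i < d \<Longrightarrow> S i \<noteq> {}"
    and ik: "i < d" "k < d" "i \<noteq> k" and j: "j \<in> S k"
  shows "Min (S i) \<le> j \<and> j \<le> Max (S i) \<longleftrightarrow> Min (S i) \<le> Min (S k) \<and> Min (S k) \<le> Max (S i)"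
proof -
  have fin: "finite (S l)" if "l < d" for l
    using nc that finite_subset[of "S l" "{..<n}"] unfolding noncrossing_partial_partition_def by auto
  have disj: "S i \<inter> S k = {}" using nc ik unfolding noncrossing_partial_partition_def by auto
  have mem: "Min (S i) \<in> S i" "Max (S i) \<in> S i" "Min (S k) \<in> S k"
    using fin ne ik by auto
  have le: "Min (S k) \<le> j" using fin ik j by auto
  have neq: "Min (S i) \<noteq> j" "Max (S i) \<noteq> j" "Min (S i) \<noteq> Min (S k)" "Max (S i) \<noteq> Min (S k)"
    using disj mem j by (metis disjoint_iff)+
  show ?thesis
  proof
    assume A: "Min (S i) \<le> j \<and> j \<le> Max (S i)"
    then have "Min (S i) < j" "j < Max (S i)" using neq by linarith+
    then have "\<not> Min (S k) < Min (S i)"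
      using noncrossingD[OF nc ik(2,1) _ mem(3) mem(1) j mem(2)] ik by blast
    then show "Min (S i) \<le> Min (S k) \<and> Min (S k) \<le> Max (S i)" using A le by linarith
  next
    assume A: "Min (S i) \<le> Min (S k) \<and> Min (S k) \<le> Max (S i)"
    then have "Min (S i) < Min (S k)" "Min (S k) < Max (S i)" using neq by linarith+
    then have "\<not> Max (S i) < j"
      using noncrossingD[OF nc ik mem(1) mem(3) mem(2) j] by blast
    then show "Min (S i) \<le> j \<and> j \<le> Max (S i)" using A le by linarith
  qed
qed

text \<open>
  The sign of block \<open>k\<close> is affected only by the choices made at the blocks whose hull contains it, so the
  signs can be adjusted one block after the other, in the order of the minima.
\<close>

lemma exists_flips:
  fixes m x :: "nat \<Rightarrow> nat" and g :: "nat \<Rightarrow> real"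
  assumes inj: "inj_on m {..<d}" and mx: "\<And>i. i < d \<Longrightarrow> m i \<le> x i"
    and i0: "i0 < d" "\<And>i. i < d \<Longrightarrow> m i0 \<le> m i"
    and g: "\<And>i. i < d \<Longrightarrow> g i \<in> {1, -1}"
  shows "\<exists>F \<subseteq> {..<d} - {i0}. \<forall>k<d.
    (\<Prod>i\<in>{..<d} - {i0}. if i \<in> F \<and> m i \<le> m k \<and> m k \<le> x i then -1 else 1) * g k = g i0"
proof -
  define \<pi> where "\<pi> F k = (\<Prod>i\<in>{..<d} - {i0}. if i \<in> F \<and> m i \<le> m k \<and> m k \<le> x i then -1 else 1 :: real)"
    for F k
  have "\<exists>F \<subseteq> {i. i < d \<and> i \<noteq> i0 \<and> m i < N}. \<forall>k<d. m k < N \<longrightarrow> \<pi> F k * g k = g i0" for N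
  proof (induction N)
    case (Suc N)
    then obtain F where F: "F \<subseteq> {i. i < d \<and> i \<noteq> i0 \<and> m i < N}"
      and Fg: "\<And>k. k < d \<Longrightarrow> m k < N \<Longrightarrow> \<pi> F k * g k = g i0" by blast
    have later: "\<pi> (insert l F) k = \<pi> F k" if "l < d" "m l = N" "m k < N" for k l
      unfolding \<pi>_def using that by (intro prod.cong) auto
    show ?case
    proof (cases "\<forall>k<d. m k = N \<longrightarrow> \<pi> F k * g k = g i0")
      case True
      then show ?thesis using F Fg by (intro exI[of _ F]) (auto simp: less_Suc_eq)
    next
      case False
      then obtain l where l: "l < d" "m l = N" "\<pi> F l * g l \<noteq> g i0" by blast
      \<comment> \<open>The sign of block \<open>i0\<close> is never wrong: its minimum is strictly
        the least, so no other block can affect it.\<close>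
      have "l \<noteq> i0"
      proof
        assume "l = i0"
        then have "\<pi> F l = 1"
          unfolding \<pi>_def using i0 inj by (intro prod.neutral) (auto simp: inj_on_def dest: antisym)
        then show False using l \<open>l = i0\<close> by simp
      qed
      have lF: "l \<notin> F" using F l by auto
      have "\<pi> (insert l F) l = - \<pi> F l"
      proof -
        have "\<pi> (insert l F) l = - (\<Prod>i\<in>{..<d} - {i0} - {l}. if i \<in> insert l F \<and> m i \<le> m l \<and> m l \<le> x i then -1 else 1)"
          unfolding \<pi>_def using \<open>l \<noteq> i0\<close> l mx by (subst prod.remove[of _ l]) auto
        also have "(\<Prod>i\<in>{..<d} - {i0} - {l}. if i \<in> insert l F \<and> m i \<le> m l \<and> m l \<le> x i then -1 else 1) =
           (\<Prod>i\<in>{..<d} - {i0} - {l}. if i \<in> F \<and> m i \<le> m l \<and> m l \<le> x i then -1 else 1 :: real)"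
          by (intro prod.cong) auto
        also have "\<dots> = \<pi> F l"
          unfolding \<pi>_def using \<open>l \<noteq> i0\<close> l lF by (subst prod.remove[of "{..<d} - {i0}" l]) auto
        finally show ?thesis .
      qed
      moreover have "\<pi> F l \<in> {1, -1}"
      proof -
        have "\<bar>\<pi> F l\<bar> = 1" unfolding \<pi>_def abs_prod by (intro prod.neutral) auto
        then show ?thesis by (auto simp: abs_if split: if_splits)
      qed
      ultimately have "\<pi> (insert l F) l * g l = g i0"
        using l g[OF l(1)] g[OF i0(1)] by auto
      moreover have "k = l" if "k < d" "m k = N" for k
        using inj l that by (auto simp: inj_on_def)
      ultimately have "\<pi> (insert l F) k * g k = g i0" if "k < d" "m k < Suc N" for k
        using that later[OF l(1,2)] Fg by (cases "m k = N") auto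
      moreover have "insert l F \<subseteq> {i. i < d \<and> i \<noteq> i0 \<and> m i < Suc N}"
        using F l \<open>l \<noteq> i0\<close> by auto
      ultimately show ?thesis by blast
    qed
  qed auto
  from this[of "Suc (Max (m ` {..<d}))"]
  obtain F where F: "F \<subseteq> {i. i < d \<and> i \<noteq> i0 \<and> m i < Suc (Max (m ` {..<d}))}"
    and Fg: "\<And>k. k < d \<Longrightarrow> m k < Suc (Max (m ` {..<d})) \<Longrightarrow> \<pi> F k * g k = g i0" by blast
  show ?thesis
    using F Fg unfolding \<pi>_def by (intro exI[of _ F]) (auto simp: less_Suc_eq_le)
qed

text \<open>Omitting one index \<open>o' i\<close> from every block except \<open>i0\<close> leaves
  \<open>n - d + 1\<close> indices. The alternating sign on \<open>J\<close> differs from the power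
  of -1 given by the position \<open>j\<close> through the number of omitted indices below
  \<open>j\<close>, and \<open>exists_flips\<close> tells whether to omit the minimum or the
  maximum.\<close>

lemma noncrossing_imp_weakly_alternating:
  fixes v r s :: "nat \<Rightarrow> real"
  assumes nc: "noncrossing_partial_partition n d S" and ne: "\<And>i. i < d \<Longrightarrow> S i \<noteq> {}" and d: "d \<ge> 1"
    and block: "\<And>i j. i < d \<Longrightarrow> j \<in> S i \<Longrightarrow>
      r j > 0 \<and> v j = (-1) ^ (j + card {i\<in>{..<d}. Min (S i) \<le> j}) * r j * s i"
    and free: "\<And>j. j < n \<Longrightarrow> (\<And>i. i < d \<Longrightarrow> j \<notin> S i) \<Longrightarrow> v j = 0"
  shows "\<exists>J \<eta>. J \<subseteq> {..<n} \<and> card J = Suc (n - d) \<and> \<eta> \<noteq> 0 \<and>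
    (\<forall>j\<in>J. \<eta> * v j * (-1) ^ card {i\<in>J. i < j} \<ge> 0)"
proof -
  define m where "m i = Min (S i)" for i
  define x where "x i = Max (S i)" for i
  have sub: "S i \<subseteq> {..<n}" if "i < d" for i
    using nc that unfolding noncrossing_partial_partition_def by auto
  have fin: "finite (S i)" if "i < d" for i using sub[OF that] finite_subset by auto
  have disj: "i = k" if "i < d" "k < d" "j \<in> S i" "j \<in> S k" for i k j
    using nc that unfolding noncrossing_partial_partition_def by (metis disjoint_iff)
  have mem: "m i \<in> S i" "x i \<in> S i" if "i < d" for i
    using fin ne that by (auto simp: m_def x_def)
  have bounds: "m i \<le> j" "j \<le> x i" if "i < d" "j \<in> S i" for i j
    using fin that by (auto simp: m_def x_def)
  have inj: "inj_on m {..<d}" using disj mem by (fastforce simp: inj_on_def)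
  obtain i0 where i0: "i0 < d" "\<And>i. i < d \<Longrightarrow> m i0 \<le> m i"
  proof -
    have "Min (m ` {..<d}) \<in> m ` {..<d}" using d by (intro Min_in) (auto simp: lessThan_empty_iff)
    then obtain i where "i < d" "m i = Min (m ` {..<d})" by auto
    then show thesis by (intro that[of i]) auto
  qed
  define A where "A = {..<d} - {i0}"
  \<comment> \<open>A vanishing \<open>s i\<close> counts as positive, which is harmless because the
    claimed inequalities are weak.\<close>
  define g where "g i = (if s i \<ge> 0 then 1 else -1 :: real)" for i
  have "\<exists>F \<subseteq> {..<d} - {i0}. \<forall>k<d.
    (\<Prod>i\<in>{..<d} - {i0}. if i \<in> F \<and> m i \<le> m k \<and> m k \<le> x i then -1 else 1) * g k = g i0"
    using bounds mem by (intro exists_flips[OF inj _ i0]) (auto simp: g_def)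
  then obtain F where F: "\<And>k. k < d \<Longrightarrow>
    (\<Prod>i\<in>A. if i \<in> F \<and> m i \<le> m k \<and> m k \<le> x i then -1 else 1) * g k = g i0"
    unfolding A_def by blast
  define o' where "o' i = (if i \<in> F then x i else m i)" for i
  define J where "J = {..<n} - o' ` A"
  have o': "o' i \<in> S i" if "i < d" for i using mem that by (simp add: o'_def)
  have inj': "inj_on o' A" using disj o' by (fastforce simp: inj_on_def A_def)
  have oA: "o' ` A \<subseteq> {..<n}" using o' sub by (fastforce simp: A_def)
  have finA: "finite A" by (simp add: A_def)
  have cardA: "card A = d - 1" using i0 by (simp add: A_def)
  have "d \<le> n" using card_inj_on_le[OF inj, of "{..<n}"] mem sub by fastforce
  then have cardJ: "card J = Suc (n - d)"
    using oA card_image[OF inj'] cardA d by (simp add: J_def card_Diff_subset finite_subset)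
  have "- g i0 * v j * (-1) ^ card {i\<in>J. i < j} \<ge> 0" if j: "j \<in> J" for j
  proof (cases "\<exists>k<d. j \<in> S k")
    case False
    then show ?thesis using free[of j] j by (auto simp: J_def)
  next
    case True
    then obtain k where k: "k < d" "j \<in> S k" by blast
    have "{..<j} = {i\<in>J. i < j} \<union> {q\<in>o' ` A. q < j}" using j by (auto simp: J_def)
    then have "j = card ({i\<in>J. i < j} \<union> {q\<in>o' ` A. q < j})" by (metis card_lessThan)
    also have "\<dots> = card {i\<in>J. i < j} + card {q\<in>o' ` A. q < j}"
      by (intro card_Un_disjoint) (auto simp: J_def A_def)
    also have "card {q\<in>o' ` A. q < j} = card {i\<in>A. o' i < j}"
    proof -
      have "{q\<in>o' ` A. q < j} = o' ` {i\<in>A. o' i < j}" by auto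
      then show ?thesis using inj' by (simp add: card_image inj_on_subset)
    qed
    finally have cj: "j = card {i\<in>J. i < j} + card {i\<in>A. o' i < j}" .
    have pj: "(-1 :: real) ^ j * (-1) ^ card {i\<in>J. i < j} = (-1) ^ card {i\<in>A. o' i < j}"
      by (subst cj) (simp add: power_add)
    \<comment> \<open>The minimum of block \<open>i0\<close> is at most \<open>j\<close>, so this
      block contributes the single factor -1.\<close>
    have "(-1 :: real) ^ card {i\<in>{..<d}. m i \<le> j} = (\<Prod>i<d. if m i \<le> j then -1 else 1)"
      by (simp add: neg_one_power_card del: lessThan_iff)
    also have "\<dots> = - (\<Prod>i\<in>A. if m i \<le> j then -1 else 1)"
      using i0 k bounds[OF k] by (subst prod.remove[of _ i0]) (auto simp: A_def intro: order_trans)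
    finally have "(-1 :: real) ^ card {i\<in>{..<d}. m i \<le> j} * (-1) ^ card {i\<in>A. o' i < j} =
      - (\<Prod>i\<in>A. (if m i \<le> j then -1 else 1) * (if o' i < j then -1 else 1))"
      by (simp only: neg_one_power_card[OF finA] prod.distrib mult_minus_left)
    \<comment> \<open>If the minimum of block \<open>i\<close> is omitted, the two factors agree, as
      \<open>j\<close> is not that minimum. If the maximum is omitted, their product is -1 exactly
      for \<open>j\<close> in the hull of the block, which depends only on the block of
      \<open>j\<close>.\<close>
    also have "(\<Prod>i\<in>A. (if m i \<le> j then -1 else 1) * (if o' i < j then -1 else 1 :: real)) =
      (\<Prod>i\<in>A. if i \<in> F \<and> m i \<le> m k \<and> m k \<le> x i then -1 else 1)"
    proof (intro prod.cong refl)
      fix i assume i: "i \<in> A"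
      then have id: "i < d" by (simp add: A_def)
      have neq: "j \<noteq> o' i" using j i by (auto simp: J_def)
      have hull: "m i \<le> j \<and> j \<le> x i \<longleftrightarrow> m i \<le> m k \<and> m k \<le> x i"
      proof (cases "i = k")
        case True
        then show ?thesis using bounds[OF k] bounds[OF k(1) mem(1)[OF k(1)]] by auto
      next
        case False
        then show ?thesis using noncrossing_hull[OF nc ne id k(1) _ k(2)] by (simp add: m_def x_def)
      qed
      have "m i \<le> x i" using bounds mem id by blast
      then show "(if m i \<le> j then -1 else 1) * (if o' i < j then -1 else 1 :: real) =
        (if i \<in> F \<and> m i \<le> m k \<and> m k \<le> x i then -1 else 1)"
        unfolding hull[symmetric] using neq by (cases "i \<in> F") (auto simp: o'_def)
    qed
    finally have sg: "(-1 :: real) ^ card {i\<in>{..<d}. m i \<le> j} * (-1) ^ card {i\<in>A. o' i < j} * g k = - g i0"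
      using F[OF k(1)] by simp
    have rj: "r j > 0" and vj: "v j = (-1) ^ (j + card {i\<in>{..<d}. m i \<le> j}) * r j * s k"
      using block[OF k] by (simp_all add: m_def)
    have gg: "g k * g k = 1" "g i0 * g i0 = 1" by (simp_all add: g_def)
    define P :: real where "P = (-1) ^ card {i\<in>{..<d}. m i \<le> j}"
    define Q :: real where "Q = (-1) ^ card {i\<in>A. o' i < j}"
    have "P * Q = P * Q * (g k * g k)" using gg by simp
    also have "\<dots> = - g i0 * g k" using sg by (simp add: P_def Q_def mult.assoc[symmetric])
    finally have PQ: "P * Q = - g i0 * g k" .
    have "- g i0 * v j * (-1) ^ card {i\<in>J. i < j} =
      - g i0 * (P * ((-1) ^ j * (-1) ^ card {i\<in>J. i < j})) * r j * s k"
      unfolding vj power_add P_def by (simp only: mult_ac)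
    also have "\<dots> = - g i0 * (- g i0 * g k) * r j * s k" unfolding pj PQ[symmetric] Q_def ..
    also have "\<dots> = (g i0 * g i0) * (r j * (s k * g k))" by simp
    also have "\<dots> = r j * (s k * g k)" using gg by simp
    also have "\<dots> \<ge> 0" using rj by (auto simp: g_def)
    finally show ?thesis .
  qed
  moreover have "J \<subseteq> {..<n}" "- g i0 \<noteq> 0" by (auto simp: J_def g_def)
  ultimately show ?thesis using cardJ by blast
qed

section \<open>Sign patterns of sines\<close>

text \<open>A strict inequality at a point of the closed interval persists nearby; the point is
  moved by \<open>h\<close> towards the interior.\<close>

lemma exists_interior_pos:
  fixes g :: "real \<Rightarrow> real"
  assumes cont: "isCont g c" and pos: "g c > 0" and c: "0 \<le> c" "c \<le> pi"
  shows "\<exists>x. 0 < x \<and> x < pi \<and> g x > 0"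
proof -
  obtain e where e: "e > 0" "\<And>x. x \<noteq> c \<Longrightarrow> \<bar>x - c\<bar> < e \<Longrightarrow> \<bar>g x - g c\<bar> < g c"
    using LIM_D[OF cont[unfolded isCont_def] pos] by auto
  define h where "h = min (e / 2) (pi / 4)"
  have h: "0 < h" "h < e" "h \<le> pi / 4" using e by (auto simp: h_def)
  define x where "x = (if c \<le> pi / 2 then c + h else c - h)"
  have "0 < x \<and> x < pi" using h c pi_gt_zero by (auto simp: x_def)
  moreover have "\<bar>g x - g c\<bar> < g c" using h by (intro e) (auto simp: x_def)
  ultimately show ?thesis by (intro exI[of _ x]) (auto simp: abs_if split: if_splits)
qed

lemma sign_mult_sin:
  assumes "\<bar>s :: real\<bar> = 1"
  shows "sin (s * x) = s * sin x"
  using assms by (auto simp: abs_if split: if_splits)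

text \<open>Two sample points, inside the interval because \<open>\<bar>q\<bar> \<ge> 1\<close>,
  have arguments \<open>pi / 4\<close> apart, and the sine cannot vanish at both.\<close>

lemma exists_sin_affine_nonzero:
  assumes "\<bar>q :: real\<bar> \<ge> 1"
  shows "\<exists>x. 0 < x \<and> x < pi \<and> sin (r + q * x) \<noteq> 0"
proof (rule ccontr)
  assume A: "\<nexists>x. 0 < x \<and> x < pi \<and> sin (r + q * x) \<noteq> 0"
  have bd: "0 < pi / (m * \<bar>q\<bar>) \<and> pi / (m * \<bar>q\<bar>) < pi" if "m \<ge> 2" for m :: real
  proof -
    have "1 < m * \<bar>q\<bar>" using mult_mono[of 2 m 1 "\<bar>q\<bar>"] assms that by simp
    then show ?thesis by (simp add: field_simps)
  qed
  let ?u = "r + q * (pi / (2 * \<bar>q\<bar>))" and ?v = "r + q * (pi / (4 * \<bar>q\<bar>))"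
  have "sin ?u = 0" using A bd[of 2] by auto
  moreover have "sin ?v = 0" using A bd[of 4] by auto
  ultimately have "sin (?u - ?v) = 0"
    using sin_diff[of ?u ?v] by (simp only: mult_zero_left mult_zero_right diff_0_right)
  moreover have "?u - ?v = sgn q * (pi / 4)" using assms by (simp add: field_simps sgn_if)
  ultimately have "sin (sgn q * (pi / 4)) = 0" by (simp only:)
  moreover have "\<bar>sgn q\<bar> = 1" using assms by (simp add: abs_sgn_eq)
  ultimately have "sgn q * sin (pi / 4) = 0" by (simp only: sign_mult_sin)
  then show False using assms by (simp add: sin_45 sgn_if split: if_splits)
qed

text \<open>Moving \<open>x\<close> from 0 to \<open>pi / \<bar>q\<bar>\<close> shifts the argument
  by half a period and reverses the sign, so one of these two points has the required sign.\<close>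

lemma exists_sin_affine_sign:
  assumes q: "\<bar>q :: real\<bar> \<ge> 1" and "sin r \<noteq> 0" and t: "\<bar>t :: real\<bar> = 1"
  shows "\<exists>x. 0 < x \<and> x < pi \<and> t * sin (r + q * x) > 0"
proof -
  have cont: "isCont (\<lambda>x. t * sin (r + q * x)) c" for c by (intro continuous_intros)
  show ?thesis
  proof (cases "t * sin r > 0")
    case True
    then show ?thesis using exists_interior_pos[OF cont, of 0] by simp
  next
    case False
    moreover have "t * sin r \<noteq> 0" using assms by auto
    ultimately have neg: "t * sin r < 0" by linarith
    have "q * (pi / \<bar>q\<bar>) = sgn q * pi" using q by (simp add: sgn_if)
    then have "sin (r + q * (pi / \<bar>q\<bar>)) = - sin r"
      using q by (auto simp: sgn_if)
    then have "t * sin (r + q * (pi / \<bar>q\<bar>)) > 0" using neg by simp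
    moreover have "pi / \<bar>q\<bar> \<le> pi" using q by (simp add: field_simps)
    ultimately show ?thesis using exists_interior_pos[OF cont, of "pi / \<bar>q\<bar>"] by simp
  qed
qed

text \<open>Angles \<open>s i * z i\<close> with \<open>z i\<close> strictly between 0 and
  \<open>pi\<close> satisfy the sign conditions automatically. With two nonzero coefficients, one
  angle makes the sine nonzero and the other corrects its sign; a single coefficient of absolute
  value at least 2 lets the argument run far enough for both signs.\<close>

lemma exists_prescribed_sin_signs:
  fixes q s :: "nat \<Rightarrow> real"
  assumes int: "\<And>i. i < d \<Longrightarrow> q i \<in> \<int>" and s: "\<And>i. i < d \<Longrightarrow> \<bar>s i\<bar> = 1" and t: "\<bar>t\<bar> = 1"
    and a: "a < d" "q a \<noteq> 0" and big: "\<bar>q a\<bar> \<noteq> 1 \<or> (\<exists>i<d. i \<noteq> a \<and> q i \<noteq> 0)"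
  shows "\<exists>y. (\<forall>i<d. s i * sin (y i) > 0) \<and> t * sin (\<Sum>i<d. q i * y i) > 0"
proof -
  have ss: "s i * s i = 1" if "i < d" for i
    using s[OF that] by (metis abs_mult_self_eq mult_1)
  have q1: "\<bar>q i * s i\<bar> \<ge> 1" if "i < d" "q i \<noteq> 0" for i
    using Ints_nonzero_abs_ge1[OF int[OF that(1)] that(2)] s[OF that(1)] by (simp add: abs_mult)
  have sum_a: "(\<Sum>i<d. q i * (s i * (z(a := x)) i)) = (\<Sum>i\<in>{..<d} - {a}. q i * (s i * z i)) + q a * s a * x"
    for z x
    using a(1) by (subst sum.remove[of _ a]) auto
  have ssin: "s i * sin (s i * x) = sin x" if "i < d" for i x
    using s[OF that] ss[OF that] by (simp add: sign_mult_sin mult.assoc[symmetric])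
  have "\<exists>z. (\<forall>i<d. 0 < z i \<and> z i < pi) \<and> t * sin (\<Sum>i<d. q i * (s i * z i)) > 0"
  proof (cases "\<exists>c<d. c \<noteq> a \<and> q c \<noteq> 0")
    case True
    then obtain c where c: "c < d" "c \<noteq> a" "q c \<noteq> 0" by blast
    define r where "r = (\<Sum>i\<in>{..<d} - {a} - {c}. q i * (s i * (pi / 2)))"
    obtain x where x: "0 < x" "x < pi" "sin (r + (q c * s c) * x) \<noteq> 0"
      using exists_sin_affine_nonzero[OF q1[OF c(1,3)]] by blast
    obtain w where w: "0 < w" "w < pi" "t * sin ((r + (q c * s c) * x) + (q a * s a) * w) > 0"
      using exists_sin_affine_sign[OF q1[OF a] x(3) t] by blast
    define z where "z = (\<lambda>_. pi / 2)(c := x)"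
    have "(\<Sum>i\<in>{..<d} - {a}. q i * (s i * z i)) = q c * s c * x + (\<Sum>i\<in>{..<d} - {a} - {c}. q i * (s i * z i))"
      using c by (subst sum.remove[of _ c]) (auto simp: z_def)
    also have "(\<Sum>i\<in>{..<d} - {a} - {c}. q i * (s i * z i)) = r"
      unfolding r_def by (intro sum.cong) (auto simp: z_def)
    finally have "t * sin (\<Sum>i<d. q i * (s i * (z(a := w)) i)) > 0"
      using w(3) unfolding sum_a by (simp add: add_ac)
    moreover have "\<forall>i<d. 0 < (z(a := w)) i \<and> (z(a := w)) i < pi" using w x by (auto simp: z_def)
    ultimately show ?thesis by blast
  next
    case False
    then have zero: "q i = 0" if "i < d" "i \<noteq> a" for i using that by blast
    define p where "p = q a * s a"
    have "\<bar>q a\<bar> \<noteq> 1" using big False by blast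
    moreover obtain l :: int where l: "q a = of_int l" using int[OF a(1)] by (auto elim: Ints_cases)
    ultimately have "\<bar>l\<bar> \<ge> 2" using a(2) by auto
    then have p: "\<bar>p\<bar> \<ge> 2" using l s[OF a(1)] by (simp add: p_def abs_mult)
    \<comment> \<open>The absolute value of \<open>p * x\<close> is \<open>pi / 2\<close> or
      \<open>3 * pi / 2\<close>, where the sine takes opposite values;
      \<open>\<bar>p\<bar> \<ge> 2\<close> keeps \<open>x\<close> below \<open>pi\<close>.\<close>
    define x where "x = (if t * sgn p > 0 then 1 else 3) * pi / (2 * \<bar>p\<bar>)"
    have "3 * pi < 4 * pi" by simp
    also have "\<dots> \<le> (2 * \<bar>p\<bar>) * pi" using p by (intro mult_right_mono) auto
    finally have x: "0 < x" "x < pi" using p pi_gt_zero by (auto simp: x_def field_simps)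
    have sgnp: "\<bar>sgn p\<bar> = 1" using p by (simp add: abs_sgn_eq)
    have "p * x = sgn p * ((if t * sgn p > 0 then 1 else 3) * pi / 2)"
      using p by (auto simp: x_def sgn_if)
    then have "sin (p * x) = sgn p * sin ((if t * sgn p > 0 then 1 else 3) * pi / 2)"
      by (simp only: sign_mult_sin[OF sgnp])
    then have "t * sin (p * x) = t * sgn p * sin ((if t * sgn p > 0 then 1 else 3) * pi / 2)"
      by simp
    moreover have "sin (3 * pi / 2) = -1" using sin_3over2_pi by simp
    moreover have "\<bar>t * sgn p\<bar> = 1" using t p by (simp add: abs_mult abs_sgn_eq)
    ultimately have "t * sin (p * x) > 0" by (auto simp: abs_if split: if_splits)
    moreover have "(\<Sum>i<d. q i * (s i * ((\<lambda>_. pi / 2)(a := x)) i)) = p * x"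
      unfolding sum_a p_def using zero by simp
    ultimately show ?thesis using x
      by (intro exI[of _ "(\<lambda>_. pi / 2)(a := x)"]) auto
  qed
  then obtain z where z: "\<And>i. i < d \<Longrightarrow> 0 < z i \<and> z i < pi" "t * sin (\<Sum>i<d. q i * (s i * z i)) > 0"
    by blast
  show ?thesis
    using z by (intro exI[of _ "\<lambda>i. s i * z i"]) (auto simp: ssin sin_gt_zero)
qed

text \<open>For \<open>J\<close> with \<open>d + 1\<close> elements, a vector having these signs on
  \<open>J\<close>, up to a common factor, lies in a member of the positive Grassmannian by
  \<open>positive_grassmannian_memberI\<close>.\<close>

definition alt_sign :: "nat set \<Rightarrow> nat \<Rightarrow> real" where
  "alt_sign J j = (-1) ^ (j + card {i\<in>J. i < j})"

lemma abs_alt_sign [simp]: "\<bar>alt_sign J j\<bar> = 1"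
  by (simp add: alt_sign_def power_abs)

lemma alt_sign_nonzero [simp]: "alt_sign J j \<noteq> 0"
  by (simp add: alt_sign_def)

lemma alt_sign_square [simp]: "alt_sign J j * alt_sign J j = 1"
  using abs_alt_sign[of J j] by (metis abs_mult_self_eq mult_1)

text \<open>
  The sine is the sign of the imaginary part at a point of the toric variety; \<open>y i\<close> is the angle
  of the character of the basis column \<open>b i\<close>.
\<close>

locale no_alternating_sines =
  fixes n d :: nat and b :: "nat \<Rightarrow> nat" and Q :: "nat \<Rightarrow> nat \<Rightarrow> real" and \<phi> :: "nat \<Rightarrow> real"
  assumes b: "\<And>i. i < d \<Longrightarrow> b i < n"
    and Qb: "\<And>i k. i < d \<Longrightarrow> k < d \<Longrightarrow> Q i (b k) = (if i = k then 1 else 0)"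
    and no_alt: "\<And>y J \<eta>. J \<subseteq> {..<n} \<Longrightarrow> card J = Suc d \<Longrightarrow>
      \<exists>j\<in>J. \<eta> * sin (\<phi> j + (\<Sum>i<d. Q i j * y i)) * alt_sign J j \<le> 0"
begin

lemma sum_Qb: "k < d \<Longrightarrow> (\<Sum>i<d. Q i (b k) * y i) = y k"
proof -
  assume k: "k < d"
  then have "(\<Sum>i<d. Q i (b k) * y i) = (\<Sum>i<d. if i = k then y i else 0)"
    by (intro sum.cong) (auto simp: Qb)
  then show ?thesis using k by simp
qed

lemma inj_b: "inj_on b {..<d}"
  by (intro inj_onI) (metis Qb lessThan_iff zero_neq_one)

lemma insert_b_card:
  assumes "k < n" "k \<notin> b ` {..<d}"
  shows "insert k (b ` {..<d}) \<subseteq> {..<n}" "card (insert k (b ` {..<d})) = Suc d"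
  using assms b inj_b by (auto simp: card_image)

text \<open>At a common zero, every basis sine can be given any sign by a small change of its own
  angle. A nonzero sine at \<open>k\<close> would keep its sign meanwhile, and the forbidden
  alternation on \<open>k\<close> and the basis columns would arise.\<close>

lemma sin_zero_everywhere:
  assumes y: "\<And>i. i < d \<Longrightarrow> sin (\<phi> (b i) + y i) = 0" and k: "k < n"
  shows "sin (\<phi> k + (\<Sum>i<d. Q i k * y i)) = 0"
proof (rule ccontr)
  assume nz: "sin (\<phi> k + (\<Sum>i<d. Q i k * y i)) \<noteq> 0"
  then have kb: "k \<notin> b ` {..<d}" using y by (auto simp: sum_Qb)
  define J where "J = insert k (b ` {..<d})"
  define \<eta> where "\<eta> = sin (\<phi> k + (\<Sum>i<d. Q i k * y i)) * alt_sign J k"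
  have \<eta>: "\<eta> \<noteq> 0" using nz by (simp add: \<eta>_def)
  \<comment> \<open>The derivative of the signed sine at column \<open>b i\<close> with respect to
    its own angle; a step in the direction \<open>sgn (\<delta> i)\<close> makes this term
    positive.\<close>
  define \<delta> where "\<delta> i = \<eta> * alt_sign J (b i) * cos (\<phi> (b i) + y i)" for i
  define z where "z e i = y i + e * sgn (\<delta> i)" for e i
  define f where "f e = sin (\<phi> k + (\<Sum>i<d. Q i k * z e i)) * sin (\<phi> k + (\<Sum>i<d. Q i k * y i))" for e
  have "isCont f 0" unfolding f_def z_def by (intro continuous_intros)
  moreover have "f 0 > 0" using nz by (auto simp: f_def z_def zero_less_mult_iff linorder_neq_iff)
  ultimately obtain e where e: "0 < e" "e < pi" "f e > 0"
    using exists_interior_pos[where g = f and c = 0] by auto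
  obtain j where j: "j \<in> J" "\<eta> * sin (\<phi> j + (\<Sum>i<d. Q i j * z e i)) * alt_sign J j \<le> 0"
    using no_alt[of J] insert_b_card[OF k kb] unfolding J_def by blast
  show False
  proof (cases "j = k")
    case True
    have "\<eta> * sin (\<phi> j + (\<Sum>i<d. Q i j * z e i)) * alt_sign J j = f e * (alt_sign J k * alt_sign J k)"
      unfolding True \<eta>_def f_def by (simp only: mult_ac)
    then show False using e j by simp
  next
    case False
    then obtain i where i: "i < d" "j = b i" using j by (auto simp: J_def)
    have "(cos (\<phi> (b i) + y i))\<^sup>2 = 1"
      using y[OF i(1)] sin_cos_squared_add[of "\<phi> (b i) + y i"] by simp
    then have "cos (\<phi> (b i) + y i) \<noteq> 0" by auto
    then have \<delta>: "\<delta> i \<noteq> 0" using \<eta> by (simp add: \<delta>_def)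
    have "sin (\<phi> j + (\<Sum>i<d. Q i j * z e i)) = sin ((\<phi> (b i) + y i) + sgn (\<delta> i) * e)"
      using i by (simp add: sum_Qb z_def add_ac mult.commute)
    also have "\<dots> = cos (\<phi> (b i) + y i) * (sgn (\<delta> i) * sin e)"
      using y[OF i(1)] \<delta> by (simp only: sin_add) (simp add: sign_mult_sin abs_sgn_eq)
    finally have "\<eta> * sin (\<phi> j + (\<Sum>i<d. Q i j * z e i)) * alt_sign J j =
      (\<delta> i * sgn (\<delta> i)) * sin e"
      unfolding i(2) \<delta>_def by (simp only: mult_ac)
    also have "\<delta> i * sgn (\<delta> i) = \<bar>\<delta> i\<bar>" by (simp add: abs_sgn)
    finally show False using j \<delta> sin_gt_zero[OF e(1,2)] by (simp add: mult_le_0_iff)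
  qed
qed

text \<open>At the angles \<open>- \<phi> (b i)\<close> all basis sines vanish, hence so does the
  sine at every \<open>k < n\<close>. Measured from there, the phase \<open>\<phi> k\<close>
  survives only as the sign \<open>\<tau> k\<close>.\<close>

definition \<tau> :: "nat \<Rightarrow> real" where
  "\<tau> k = cos (\<phi> k + (\<Sum>i<d. Q i k * - \<phi> (b i)))"

lemma sin_shift:
  assumes "k < n"
  shows "sin (\<phi> k + (\<Sum>i<d. Q i k * (y i - \<phi> (b i)))) = \<tau> k * sin (\<Sum>i<d. Q i k * y i)"
    and "\<bar>\<tau> k\<bar> = 1"
proof -
  have 0: "sin (\<phi> k + (\<Sum>i<d. Q i k * - \<phi> (b i))) = 0"
    using assms by (intro sin_zero_everywhere) auto
  have "\<phi> k + (\<Sum>i<d. Q i k * (y i - \<phi> (b i))) = (\<phi> k + (\<Sum>i<d. Q i k * - \<phi> (b i))) + (\<Sum>i<d. Q i k * y i)"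
    by (simp add: sum_subtractf right_diff_distrib sum_negf)
  then show "sin (\<phi> k + (\<Sum>i<d. Q i k * (y i - \<phi> (b i)))) = \<tau> k * sin (\<Sum>i<d. Q i k * y i)"
    using 0 by (simp only: sin_add \<tau>_def)
  show "\<bar>\<tau> k\<bar> = 1" unfolding \<tau>_def using 0 sin_zero_abs_cos_one by blast
qed

lemma no_alt_shifted:
  assumes "J \<subseteq> {..<n}" "card J = Suc d"
  shows "\<exists>j\<in>J. \<tau> j * sin (\<Sum>i<d. Q i j * y i) * alt_sign J j \<le> 0"
proof -
  obtain j where j: "j \<in> J"
    "1 * sin (\<phi> j + (\<Sum>i<d. Q i j * (y i - \<phi> (b i)))) * alt_sign J j \<le> 0"
    using no_alt[OF assms, of 1 "\<lambda>i. y i - \<phi> (b i)"] by blast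
  moreover have "j < n" using j(1) assms(1) by auto
  ultimately show ?thesis by (auto simp only: sin_shift(1) mult_1_left)
qed

text \<open>Adding \<open>pi\<close> to a single angle leads to another common zero of the basis
  sines, so the sine of \<open>Q a k * pi\<close> vanishes.\<close>

lemma Q_int:
  assumes "k < n" "a < d"
  shows "Q a k \<in> \<int>"
proof -
  define y where "y i = (if i = a then pi else 0)" for i
  have "(\<Sum>i<d. Q i k * y i) = Q a k * pi"
    using assms(2) by (simp add: y_def sum.delta if_distrib cong: if_cong)
  moreover have "sin (\<phi> k + (\<Sum>i<d. Q i k * (y i - \<phi> (b i)))) = 0"
    using assms(1) by (intro sin_zero_everywhere) (auto simp: y_def)
  ultimately have "sin (Q a k * pi) = 0" using sin_shift[OF assms(1)] by auto
  then show ?thesis by (auto simp: sin_zero_iff_int2)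
qed

text \<open>For any other integral column, \<open>exists_prescribed_sin_signs\<close> would allow
  the sign at \<open>k\<close> to be chosen independently of the signs at the basis columns, and the
  forbidden alternation could be realised.\<close>

lemma Q_column:
  assumes k: "k < n" and a: "a < d" "Q a k \<noteq> 0"
  shows "\<bar>Q a k\<bar> = 1 \<and> (\<forall>i<d. i \<noteq> a \<longrightarrow> Q i k = 0)"
proof (rule ccontr)
  assume neg: "\<not> ?thesis"
  then have kb: "k \<notin> b ` {..<d}" using a Qb by (auto split: if_splits)
  define J where "J = insert k (b ` {..<d})"
  have sgn1: "\<bar>\<tau> j * alt_sign J j\<bar> = 1" if "j < n" for j
    using sin_shift(2)[OF that] by (simp add: abs_mult)
  obtain y where y: "\<And>i. i < d \<Longrightarrow> \<tau> (b i) * alt_sign J (b i) * sin (y i) > 0"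
    "\<tau> k * alt_sign J k * sin (\<Sum>i<d. Q i k * y i) > 0"
    using exists_prescribed_sin_signs[of d "\<lambda>i. Q i k" "\<lambda>i. \<tau> (b i) * alt_sign J (b i)"
        "\<tau> k * alt_sign J k" a] Q_int[OF k] sgn1 b k a neg by blast
  obtain j where j: "j \<in> J" "\<tau> j * sin (\<Sum>i<d. Q i j * y i) * alt_sign J j \<le> 0"
    using no_alt_shifted[of J] insert_b_card[OF k kb] unfolding J_def by blast
  have "\<tau> j * alt_sign J j * sin (\<Sum>i<d. Q i j * y i) > 0"
    using j(1) y by (auto simp: J_def sum_Qb)
  then show False using j(2) by (simp add: mult_ac)
qed

lemma sum_column:
  assumes "k < n" "a < d" "Q a k \<noteq> 0"
  shows "(\<Sum>i<d. Q i k * y i) = Q a k * y a"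
  using Q_column[OF assms] assms(2) by (subst sum.remove[of _ a]) (auto intro: sum.neutral)

text \<open>
  Choosing the angles so that all the representatives have the required sign, the remaining
  index \<open>q\<close> must have the wrong one.
\<close>

lemma parallel_columns_sign:
  assumes \<rho>: "\<And>i. i < d \<Longrightarrow> \<rho> i < n \<and> Q i (\<rho> i) \<noteq> 0"
    and a: "a < d" and q: "q < n" "Q a q \<noteq> 0" "q \<noteq> \<rho> a"
  defines "J \<equiv> insert q (\<rho> ` {..<d})"
  shows "\<tau> q * Q a q * \<tau> (\<rho> a) * Q a (\<rho> a) * alt_sign J q * alt_sign J (\<rho> a) = -1"
proof -
  have only: "i = l" if "i < d" "l < d" "k < n" "Q i k \<noteq> 0" "Q l k \<noteq> 0" for i l k
    using Q_column that by metis
  have "q \<notin> \<rho> ` {..<d}" using only[OF a _ q(1,2)] \<rho> q(3) by auto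
  moreover have "inj_on \<rho> {..<d}"
  proof (rule inj_onI)
    fix i l assume "i \<in> {..<d}" "l \<in> {..<d}" "\<rho> i = \<rho> l"
    then show "i = l" using only[of i l "\<rho> i"] \<rho>[of i] \<rho>[of l] by simp
  qed
  ultimately have J: "J \<subseteq> {..<n}" "card J = Suc d"
    using \<rho> q by (auto simp: J_def card_image)
  have \<tau>1: "\<bar>\<tau> k\<bar> = 1" "\<tau> k * \<tau> k = 1" if "k < n" for k
    using sin_shift(2)[OF that] abs_mult_self_eq[of "\<tau> k"] by simp_all
  have Q1: "\<bar>Q i (\<rho> i)\<bar> = 1" "Q i (\<rho> i) * Q i (\<rho> i) = 1" if "i < d" for i
    using Q_column[of "\<rho> i" i] \<rho>[OF that] that abs_mult_self_eq[of "Q i (\<rho> i)"] by simp_all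
  \<comment> \<open>Angles of absolute value \<open>pi / 2\<close> make the sine equal to the
    prescribed sign.\<close>
  define y where "y i = \<tau> (\<rho> i) * Q i (\<rho> i) * alt_sign J (\<rho> i) * (pi / 2)" for i
  have sy: "sin (y i) = \<tau> (\<rho> i) * Q i (\<rho> i) * alt_sign J (\<rho> i)" if "i < d" for i
    unfolding y_def using \<tau>1 Q1 \<rho> that by (subst sign_mult_sin) (auto simp: abs_mult)
  have sQ: "sin (Q i k * y i) = Q i k * sin (y i)" if "i < d" "k < n" "Q i k \<noteq> 0" for i k
    using Q_column that by (intro sign_mult_sin) auto
  obtain j where j: "j \<in> J" "\<tau> j * sin (\<Sum>i<d. Q i j * y i) * alt_sign J j \<le> 0"
    using no_alt_shifted[OF J] by blast
  have "j \<notin> \<rho> ` {..<d}"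
  proof
    assume "j \<in> \<rho> ` {..<d}"
    then obtain i where i: "i < d" "j = \<rho> i" by auto
    have \<rho>i: "\<rho> i < n" "Q i (\<rho> i) \<noteq> 0" using \<rho>[OF i(1)] by auto
    have "\<tau> j * sin (\<Sum>i<d. Q i j * y i) * alt_sign J j =
      (\<tau> j * \<tau> j) * (Q i (\<rho> i) * Q i (\<rho> i)) * (alt_sign J j * alt_sign J j)"
      unfolding i(2) sum_column[OF \<rho>i(1) i(1) \<rho>i(2)] sQ[OF i(1) \<rho>i] sy[OF i(1)]
      by (simp only: mult_ac)
    then show False using j(2) \<tau>1 Q1 i \<rho> by simp
  qed
  then have "j = q" using j by (simp add: J_def)
  define p where "p = \<tau> q * Q a q * \<tau> (\<rho> a) * Q a (\<rho> a) * alt_sign J q * alt_sign J (\<rho> a)"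
  have "p \<le> 0"
    using j(2) unfolding p_def \<open>j = q\<close> sum_column[OF q(1) a q(2)] sQ[OF a q(1,2)] sy[OF a]
    by (simp only: mult_ac)
  moreover have "\<bar>p\<bar> = 1"
    using \<tau>1 Q1 a q \<rho> Q_column[OF q(1) a q(2)] by (simp add: p_def abs_mult)
  ultimately show ?thesis unfolding p_def by linarith
qed

text \<open>\<open>parallel_columns_sign\<close> is applied twice to \<open>j1\<close> and
  \<open>j3\<close>, with block \<open>l\<close> represented by \<open>j2\<close> and then by
  \<open>j4\<close>. The product of the alternating signs at \<open>j1\<close> and \<open>j3\<close>
  depends on the parity of the number of chosen indices between them. Only \<open>j2\<close> lies
  between, so the two results contradict each other.\<close>

lemma no_crossing:
  assumes il: "i < d" "l < d" "i \<noteq> l"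
    and j: "j1 < j2" "j2 < j3" "j3 < j4" "j4 < n"
    and Q: "Q i j1 \<noteq> 0" "Q i j3 \<noteq> 0" "Q l j2 \<noteq> 0" "Q l j4 \<noteq> 0"
  shows False
proof -
  define R where "R = insert j3 (insert j1 (b ` ({..<d} - {i, l})))"
  have only: "i = l" if "i < d" "l < d" "k < n" "Q i k \<noteq> 0" "Q l k \<noteq> 0" for i l k
    using Q_column that by metis
  have fin: "finite R" by (simp add: R_def)
  have sgn: "\<tau> j3 * Q i j3 * \<tau> j1 * Q i j1 * (alt_sign (insert x R) j3 * alt_sign (insert x R) j1) = -1"
    if x: "x < n" "Q l x \<noteq> 0" for x
  proof -
    \<comment> \<open>Block \<open>i\<close> is represented by \<open>j1\<close>, block
      \<open>l\<close> by \<open>x\<close> and every other block by its basis column; with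
      \<open>j3\<close> as the extra index, only \<open>x\<close> varies.\<close>
    define \<rho> where "\<rho> = b(i := j1, l := x)"
    have "insert j3 (\<rho> ` {..<d}) = insert x R"
      using il by (auto simp: \<rho>_def R_def)
    moreover have "\<rho> k < n \<and> Q k (\<rho> k) \<noteq> 0" if "k < d" for k
      using that b Qb x j Q by (auto simp: \<rho>_def)
    moreover have "\<rho> i = j1" using il by (simp add: \<rho>_def)
    ultimately show ?thesis
      using parallel_columns_sign[of \<rho> i j3] il j Q by (simp add: mult.assoc)
  qed
  have sg: "alt_sign J j3 * alt_sign J j1 = (-1) ^ (j1 + j3) * (-1) ^ card {k\<in>J. j1 \<le> k \<and> k < j3}"
    if "finite J" for J
  proof -
    have "{k\<in>J. k < j3} = {k\<in>J. k < j1} \<union> {k\<in>J. j1 \<le> k \<and> k < j3}" using j by auto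
    moreover have "card ({k\<in>J. k < j1} \<union> {k\<in>J. j1 \<le> k \<and> k < j3}) =
      card {k\<in>J. k < j1} + card {k\<in>J. j1 \<le> k \<and> k < j3}"
      using that by (intro card_Un_disjoint) auto
    ultimately have "card {k\<in>J. k < j3} = card {k\<in>J. k < j1} + card {k\<in>J. j1 \<le> k \<and> k < j3}"
      by (simp only:)
    then have "alt_sign J j3 * alt_sign J j1 = (-1) ^ (j1 + j3) * (-1) ^ card {k\<in>J. j1 \<le> k \<and> k < j3} *
       ((-1) ^ card {k\<in>J. k < j1} * (-1) ^ card {k\<in>J. k < j1})"
      unfolding alt_sign_def by (simp only: power_add mult_ac)
    then show ?thesis by (simp add: power_add[symmetric] mult_2[symmetric])
  qed
  have "j2 \<notin> R"
  proof
    assume "j2 \<in> R"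
    then obtain k where "k < d" "k \<noteq> i" "k \<noteq> l" "j2 = b k" using j by (auto simp: R_def)
    then show False using Qb[of l k] Q il by auto
  qed
  have "{k \<in> insert j2 R. j1 \<le> k \<and> k < j3} = insert j2 {k\<in>insert j4 R. j1 \<le> k \<and> k < j3}"
    "j2 \<notin> {k\<in>insert j4 R. j1 \<le> k \<and> k < j3}"
    using j \<open>j2 \<notin> R\<close> by auto
  then have "alt_sign (insert j2 R) j3 * alt_sign (insert j2 R) j1 =
      - (alt_sign (insert j4 R) j3 * alt_sign (insert j4 R) j1)"
    using fin by (simp add: sg)
  then show False using sgn[of j2] sgn[of j4] j Q by simp
qed

lemma noncrossing_supports:
  "noncrossing_partial_partition n d (\<lambda>i. {j. j < n \<and> Q i j \<noteq> 0})"
  unfolding noncrossing_partial_partition_def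
proof (intro conjI allI impI notI)
  fix i k assume ik: "i < d" "k < d" "i \<noteq> k"
  show "{j. j < n \<and> Q i j \<noteq> 0} \<inter> {j. j < n \<and> Q k j \<noteq> 0} = {}"
    using Q_column ik by blast
  assume "\<exists>p q r s. cyclic_order4 p q r s \<and> p \<in> {j. j < n \<and> Q i j \<noteq> 0} \<and> r \<in> {j. j < n \<and> Q i j \<noteq> 0}
    \<and> q \<in> {j. j < n \<and> Q k j \<noteq> 0} \<and> s \<in> {j. j < n \<and> Q k j \<noteq> 0}"
  then obtain p q r s where "cyclic_order4 p q r s" and
    lt: "p < n" "q < n" "r < n" "s < n" and nz: "Q i p \<noteq> 0" "Q i r \<noteq> 0" "Q k q \<noteq> 0" "Q k s \<noteq> 0"
    by blast
  \<comment> \<open>Each rotation of the cyclic order by one position exchanges the roles of the two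
    blocks.\<close>
  then consider "p < q" "q < r" "r < s" | "q < r" "r < s" "s < p" | "r < s" "s < p" "p < q" | "s < p" "p < q" "q < r"
    unfolding cyclic_order4_def by blast
  then show False
    using no_crossing[OF ik] no_crossing[OF ik(2,1) ik(3)[symmetric]] lt nz by cases blast+
qed auto

end

section \<open>Positive hyperbolicity of toric varieties\<close>

lemma toric_point_mem:
  assumes "A \<in> carrier_mat d n" "x \<in> complex_torus d"
  shows "scaled_monomial_map l A x \<in> toric_variety l A"
  using assms subset_zariski_closure unfolding toric_variety_def by blast

text \<open>This carries properties of the parametrised points over to the rest of the closure,
  where no torus parameters are available.\<close>

lemma toric_variety_relation:
  assumes A: "A \<in> carrier_mat d n" and f: "f \<in> polynomial_functions n"
    and zero: "\<And>x. x \<in> complex_torus d \<Longrightarrow> f (scaled_monomial_map l A x) = 0"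
    and x: "x \<in> toric_variety l A"
  shows "f x = 0"
proof -
  have "scaled_monomial_map l A ` complex_torus d \<subseteq> carrier_vec n"
    using A by (auto simp: scaled_monomial_map_def)
  then show ?thesis
    using x A f zero unfolding toric_variety_def by (auto simp: zariski_closure_eq)
qed

lemma toric_variety_carrier:
  assumes "A \<in> carrier_mat d n"
  shows "toric_variety l A \<subseteq> carrier_vec n"
proof -
  have "scaled_monomial_map l A ` complex_torus d \<subseteq> carrier_vec n"
    using assms by (auto simp: scaled_monomial_map_def)
  then show ?thesis using assms by (auto simp: toric_variety_def zariski_closure_eq)
qed

lemma irreducible_dim_toric_variety:
  assumes A: "A \<in> carrier_mat d n" and G: "G \<in> carrier_mat d d" and l: "l \<in> complex_torus n"
    and b: "\<And>i. i < d \<Longrightarrow> b i < n"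
    and Gb: "\<And>i k. i < d \<Longrightarrow> k < d \<Longrightarrow> (G * map_mat rat_of_int A) $$ (i, b k) = (if i = k then 1 else 0)"
  shows "irreducible_dim n (toric_variety l A) = d"
  unfolding irreducible_dim_def
proof (rule Greatest_equality)
  show "\<exists>fs. (\<forall>j<d. fs j \<in> polynomial_functions n) \<and>
      algebraically_independent_on (toric_variety l A) d fs"
    using toric_variety_dim_ge[OF A G l b Gb] b
    by (intro exI[of _ "\<lambda>i x. x $ b i"]) (auto intro: polynomial_functions.coord)
qed (use toric_variety_dim_le[OF A] in blast)

text \<open>Irreducibility leaves \<open>n - d\<close> as the only codimension, and it is below
  \<open>n\<close> because \<open>d \<ge> 1\<close>.\<close>

lemma positively_hyperbolic_toric_variety_iff:
  assumes A: "A \<in> carrier_mat d n" and dim: "irreducible_dim n (toric_variety l A) = d"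
    and d: "1 \<le> d" "d \<le> n"
  shows "positively_hyperbolic n (toric_variety l A) \<longleftrightarrow>
    (\<forall>L \<in> positive_grassmannian (n - d) n. \<forall>x \<in> toric_variety l A. map_vec Im x \<notin> L - {0\<^sub>v n})"
proof -
  have "equidimensional_codim n c (toric_variety l A) \<longleftrightarrow> c = n - d" for c
    using equidimensional_codim_irreducible_iff[OF irreducible_toric_variety[OF A]] dim d by auto
  then show ?thesis using d unfolding positively_hyperbolic_def by auto
qed

lemma signed_unit_columns_iff:
  fixes B :: "rat mat"
  assumes B: "B \<in> carrier_mat d n"
  shows "signed_unit_columns B \<longleftrightarrow>
    (\<forall>j<n. \<forall>i<d. B $$ (i, j) \<noteq> 0 \<longrightarrow> \<bar>B $$ (i, j)\<bar> = 1 \<and> (\<forall>k<d. k \<noteq> i \<longrightarrow> B $$ (k, j) = 0))"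
    (is "_ \<longleftrightarrow> ?R")
proof
  assume S: "signed_unit_columns B"
  show ?R
  proof (intro allI impI)
    fix i j assume ij: "j < n" "i < d" "B $$ (i, j) \<noteq> 0"
    have ent: "B $$ (k, j) = col B j $ k" if "k < d" for k using that ij B by simp
    consider "col B j = 0\<^sub>v d" | l where "l < d" "col B j = unit_vec d l" | l where "l < d" "col B j = - unit_vec d l"
      using S ij B unfolding signed_unit_columns_def by auto
    then show "\<bar>B $$ (i, j)\<bar> = 1 \<and> (\<forall>k<d. k \<noteq> i \<longrightarrow> B $$ (k, j) = 0)"
      using ij(2,3) by cases (auto simp: ent unit_vec_def split: if_splits)
  qed
next
  assume R: ?R
  show "signed_unit_columns B"
    unfolding signed_unit_columns_def
  proof (intro allI impI)
    fix j assume "j < dim_col B"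
    then have j: "j < n" using B by simp
    show "col B j \<in> {0\<^sub>v (dim_row B)} \<union> {unit_vec (dim_row B) i | i. i < dim_row B}
        \<union> {- unit_vec (dim_row B) i | i. i < dim_row B}"
    proof (cases "\<exists>i<d. B $$ (i, j) \<noteq> 0")
      case False
      then have "col B j = 0\<^sub>v d" using j B by (intro eq_vecI) auto
      then show ?thesis using B by simp
    next
      case True
      then obtain i where i: "i < d" "B $$ (i, j) \<noteq> 0" by blast
      then have c: "\<bar>B $$ (i, j)\<bar> = 1 \<and> (\<forall>k<d. k \<noteq> i \<longrightarrow> B $$ (k, j) = 0)"
        using R j by blast
      then have "B $$ (i, j) = 1 \<or> B $$ (i, j) = -1" by (auto simp: abs_if split: if_splits)
      then have "col B j = unit_vec d i \<or> col B j = - unit_vec d i"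
      proof
        assume "B $$ (i, j) = 1"
        then have "col B j = unit_vec d i"
          using j B i(1) c by (intro eq_vecI) auto
        then show ?thesis ..
      next
        assume "B $$ (i, j) = -1"
        then have "col B j = - unit_vec d i"
          using j B i(1) c by (intro eq_vecI) auto
        then show ?thesis ..
      qed
      then show ?thesis using B i by auto
    qed
  qed
qed

lemma complex_of_real_of_rat: "complex_of_real (real_of_rat q) = of_rat q"
  by (cases q) (simp add: of_rat_rat)

text \<open>Real angles \<open>y\<close> give points whose imaginary parts are positive multiples of
  the sines in \<open>no_alternating_sines\<close>. An alternating pattern would put a nonzero
  vector of imaginary parts into a member of the positive Grassmannian, so the locale applies and
  describes \<open>B\<close>.\<close>

lemma positively_hyperbolic_imp_noncrossing:
  assumes A: "A \<in> carrier_mat d n" and d: "d \<ge> 1" and l: "l \<in> complex_torus n"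
    and G: "G \<in> carrier_mat d d" "invertible_mat G" and b: "\<And>i. i < d \<Longrightarrow> b i < n"
    and Gb: "\<And>i k. i < d \<Longrightarrow> k < d \<Longrightarrow> (G * map_mat rat_of_int A) $$ (i, b k) = (if i = k then 1 else 0)"
    and dn: "d \<le> n"
    and ph: "positively_hyperbolic n (toric_variety l A)"
  shows "noncrossing_up_to_GL A"
proof -
  define B where "B = G * map_mat rat_of_int A"
  have B: "B \<in> carrier_mat d n" using A G by (simp add: B_def)
  define Q where "Q i j = real_of_rat (B $$ (i, j))" for i j
  define \<phi> where "\<phi> j = Arg (l $ j)" for j
  have ph': "map_vec Im x \<notin> L - {0\<^sub>v n}"
    if "L \<in> positive_grassmannian (n - d) n" "x \<in> toric_variety l A" for L x
    using ph positively_hyperbolic_toric_variety_iff[OF A irreducible_dim_toric_variety[OF A G(1) l b Gb] d dn]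
      that by blast
  interpret no_alternating_sines n d b Q \<phi>
  proof
    show "b i < n" if "i < d" for i using b that .
    show "Q i (b k) = (if i = k then 1 else 0)" if "i < d" "k < d" for i k
      using Gb[OF that] by (simp add: Q_def B_def)
    fix y :: "nat \<Rightarrow> real" and J \<eta> assume J: "J \<subseteq> {..<n}" "card J = Suc d"
    show "\<exists>j\<in>J. \<eta> * sin (\<phi> j + (\<Sum>i<d. Q i j * y i)) * alt_sign J j \<le> 0"
    proof (rule ccontr)
      assume neg: "\<not> ?thesis"
      \<comment> \<open>The logarithms are purely imaginary, so that every monomial has modulus
        1.\<close>
      obtain x where x: "x \<in> complex_torus d" "\<And>j. j < n \<Longrightarrow> scaled_monomial_map l A x $ j =
          l $ j * exp (\<Sum>i<d. of_rat ((G * map_mat rat_of_int A) $$ (i, j)) * (\<i> * of_real (y i)))"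
        using toric_point[OF A G(1), of l "\<lambda>i. \<i> * of_real (y i)"] by blast
      define p where "p = scaled_monomial_map l A x"
      have p: "p \<in> toric_variety l A" using toric_point_mem[OF A x(1)] by (simp add: p_def)
      have im: "Im (p $ j) = cmod (l $ j) * sin (\<phi> j + (\<Sum>i<d. Q i j * y i))" if j: "j < n" for j
      proof -
        have "(\<Sum>i<d. of_rat (B $$ (i, j)) * (\<i> * complex_of_real (y i))) = \<i> * complex_of_real (\<Sum>i<d. Q i j * y i)"
          by (simp add: Q_def sum_distrib_left complex_of_real_of_rat mult_ac)
        then have "p $ j = l $ j * cis (\<Sum>i<d. Q i j * y i)"
          using x(2)[OF j] by (simp add: p_def B_def[symmetric] cis_conv_exp)
        also have "l $ j = rcis (cmod (l $ j)) (\<phi> j)" by (simp add: \<phi>_def rcis_cmod_Arg)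
        also have "\<dots> * cis (\<Sum>i<d. Q i j * y i) = rcis (cmod (l $ j)) (\<phi> j + (\<Sum>i<d. Q i j * y i))"
          by (simp add: rcis_def cis_mult[symmetric] mult.assoc)
        finally show ?thesis by simp
      qed
      have pc: "p \<in> carrier_vec n" using p toric_variety_carrier[OF A] by blast
      have pos: "\<eta> * map_vec Im p $ j * (-1) ^ (j + card {i\<in>J. i < j}) > 0" if j: "j \<in> J" for j
      proof -
        have jn: "j < n" using j J by auto
        have "0 < cmod (l $ j) * (\<eta> * sin (\<phi> j + (\<Sum>i<d. Q i j * y i)) * alt_sign J j)"
          using neg j l jn by (intro mult_pos_pos[of "cmod (l $ j)"]) (auto simp: complex_torus_def not_le)
        then show ?thesis using im[OF jn] pc jn by (simp add: alt_sign_def mult_ac)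
      qed
      then obtain L where L: "L \<in> positive_grassmannian (n - d) n" "map_vec Im p \<in> L"
        using positive_grassmannian_memberI[OF J, of "map_vec Im p" \<eta>] pc by auto
      obtain j where j: "j \<in> J" using J by fastforce
      then have "map_vec Im p \<noteq> 0\<^sub>v n" using pos[OF j] J by auto
      then show False using ph'[OF L(1) p] L(2) by blast
    qed
  qed
  have "signed_unit_columns B"
    unfolding signed_unit_columns_iff[OF B]
  proof (intro allI impI)
    fix i j assume ij: "j < n" "i < d" "B $$ (i, j) \<noteq> 0"
    then have "\<bar>Q i j\<bar> = 1" "\<And>k. k < d \<Longrightarrow> k \<noteq> i \<Longrightarrow> Q k j = 0"
      using Q_column[of j i] by (auto simp: Q_def)
    then show "\<bar>B $$ (i, j)\<bar> = 1 \<and> (\<forall>k<d. k \<noteq> i \<longrightarrow> B $$ (k, j) = 0)"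
      by (auto simp: Q_def abs_if split: if_splits simp flip: of_rat_minus)
  qed
  moreover have "noncrossing_partial_partition n d (row_support B)"
  proof -
    have "row_support B = (\<lambda>i. {j. j < n \<and> Q i j \<noteq> 0})"
      using B by (auto simp: row_support_def Q_def fun_eq_iff)
    then show ?thesis using noncrossing_supports by simp
  qed
  ultimately show ?thesis
    using A B G unfolding noncrossing_up_to_GL_def by (intro bexI[of _ G]) (auto simp: Let_def B_def)
qed

section \<open>Sufficiency of the non-crossing condition\<close>

lemma invertible_mat_left_inverse:
  assumes G: "G \<in> carrier_mat d d" and "invertible_mat G"
  obtains H where "H \<in> carrier_mat d d" "H * G = 1\<^sub>m d"
proof -
  obtain H where "inverts_mat G H" "inverts_mat H G"
    using assms(2) unfolding invertible_mat_def by blast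
  then have HG: "H * G = 1\<^sub>m (dim_row H)" and GH: "G * H = 1\<^sub>m d"
    using G unfolding inverts_mat_def by auto
  have "dim_col H = d" using arg_cong[OF GH, of dim_col] by simp
  moreover have "dim_row H = d" using arg_cong[OF HG, of dim_col] G by simp
  ultimately show thesis using that[of H] HG by auto
qed

text \<open>The columns \<open>b i\<close> form an invertible matrix \<open>N\<close>, so
  \<open>G * N\<close> is invertible too and has no zero row. Nonempty supports give every block a
  least element.\<close>

lemma row_support_nonempty:
  fixes A :: "'a :: field mat"
  assumes A: "A \<in> carrier_mat d n" and G: "G \<in> carrier_mat d d" "invertible_mat G"
    and rank: "vec_space.rank d A = d" and i: "i < d"
  shows "row_support (G * A) i \<noteq> {}"
proof
  assume empty: "row_support (G * A) i = {}"
  obtain H b where H: "H \<in> carrier_mat d d" and b: "\<And>i. i < d \<Longrightarrow> b i < n"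
    and Hb: "\<And>i k. i < d \<Longrightarrow> k < d \<Longrightarrow> (H * A) $$ (i, b k) = (if i = k then 1 else 0)"
    using full_rank_column_basis[OF A rank] by metis
  define N where "N = mat d d (\<lambda>(i, k). A $$ (i, b k))"
  have N: "N \<in> carrier_mat d d" by (simp add: N_def)
  have prod: "(P * N) $$ (i, k) = (P * A) $$ (i, b k)" if "P \<in> carrier_mat d d" "i < d" "k < d" for P i k
    using that A b by (simp add: N_def scalar_prod_def)
  have "H * N = 1\<^sub>m d"
  proof (rule eq_matI)
    fix i k assume "i < dim_row (1\<^sub>m d :: 'a mat)" "k < dim_col (1\<^sub>m d :: 'a mat)"
    then have ik: "i < d" "k < d" by simp_all
    then show "(H * N) $$ (i, k) = 1\<^sub>m d $$ (i, k)" unfolding prod[OF H ik] Hb[OF ik] by simp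
  qed (use H N in auto)
  then have "det H * det N = 1" using det_mult[OF H N] by simp
  moreover obtain G' where G': "G' \<in> carrier_mat d d" "G' * G = 1\<^sub>m d"
    using invertible_mat_left_inverse[OF G] .
  then have "det G' * det G = 1" using det_mult[OF G'(1) G(1)] by simp
  ultimately have "det (G * N) \<noteq> 0" using det_mult[OF G(1) N] by auto
  moreover have "(G * N) $$ (i, k) = 0" if "k < d" for k
    using empty prod[OF G(1) i that] b[OF that] A by (auto simp: row_support_def)
  then have "det (G * N) = 0"
    using laplace_expansion_row[OF mult_carrier_mat[OF G(1) N] i] by simp
  ultimately show False by simp
qed

text \<open>The reversal of sign under inversion is compensated by the sign of the column entry in
  the choice of \<open>l\<close>.\<close>

lemma Im_inverse_scaled: "Im (of_real a / z) = - a * Im z / (cmod z)\<^sup>2"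
  by (simp add: Im_divide cmod_power2)

text \<open>Inside a block, each coordinate is a real multiple of the one at the least element or of
  its inverse, also on the closure. With the signs in \<open>l\<close>, the imaginary parts have the
  pattern \<open>\<sigma>\<close> up to positive factors and one real number per block, so they
  weakly alternate along \<open>n - d + 1\<close> indices.\<close>

lemma noncrossing_imp_positively_hyperbolic:
  assumes A: "A \<in> carrier_mat d n" and d: "d \<ge> 1" and rank: "vec_space.rank d (map_mat rat_of_int A) = d"
    and nc: "noncrossing_up_to_GL A" and dn: "d \<le> n"
    and dim: "\<And>l. l \<in> complex_torus n \<Longrightarrow> irreducible_dim n (toric_variety l A) = d"
  shows "\<exists>l \<in> carrier_vec n. (\<forall>i<n. l $ i \<in> {1, -1}) \<and> positively_hyperbolic n (toric_variety l A)"
proof -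
  obtain G where G: "G \<in> carrier_mat d d" "invertible_mat G"
    and signed: "signed_unit_columns (G * map_mat rat_of_int A)"
    and ncS: "noncrossing_partial_partition n d (row_support (G * map_mat rat_of_int A))"
    using nc A unfolding noncrossing_up_to_GL_def Let_def by auto
  define B where "B = G * map_mat rat_of_int A"
  have B: "B \<in> carrier_mat d n" using A G by (simp add: B_def)
  define S where "S = row_support B"
  note ncS = ncS[folded B_def S_def]
  have ne: "S i \<noteq> {}" if "i < d" for i
    using row_support_nonempty[OF _ G rank that] A by (simp add: S_def B_def)
  have S: "j \<in> S i \<longleftrightarrow> j < n \<and> B $$ (i, j) \<noteq> 0" if "i < d" for i j
    using B that by (auto simp: S_def row_support_def)
  have unit: "\<bar>B $$ (i, j)\<bar> = 1" "\<And>k. k < d \<Longrightarrow> k \<noteq> i \<Longrightarrow> B $$ (k, j) = 0" if "i < d" "j \<in> S i" for i j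
    using signed[folded B_def, unfolded signed_unit_columns_iff[OF B]] that S[OF that(1), of j] by blast+
  \<comment> \<open>Recovering \<open>A\<close> from \<open>B\<close> transfers coincidences between
    columns of \<open>B\<close> to the integral exponents.\<close>
  obtain H where H: "H \<in> carrier_mat d d" "H * G = 1\<^sub>m d"
    using invertible_mat_left_inverse[OF G] .
  have "H * B = (H * G) * map_mat rat_of_int A"
    unfolding B_def using H(1) G(1) A by (intro assoc_mult_mat[symmetric]) auto
  then have HB: "H * B = map_mat rat_of_int A" using H(2) A by simp
  have AHB: "rat_of_int (A $$ (k, j)) = (\<Sum>i<d. H $$ (k, i) * B $$ (i, j))" if "k < d" "j < n" for k j
  proof -
    have "rat_of_int (A $$ (k, j)) = (H * B) $$ (k, j)" unfolding HB using that A by simp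
    then show ?thesis using that H(1) B by (simp add: scalar_prod_def lessThan_atLeast0)
  qed
  have A_block: "rat_of_int (A $$ (k, j)) = H $$ (k, i) * B $$ (i, j)"
    if "k < d" "i < d" "j \<in> S i" for i j k
  proof -
    have "(\<Sum>l\<in>{..<d} - {i}. H $$ (k, l) * B $$ (l, j)) = 0"
      using unit(2)[OF that(2,3)] by (intro sum.neutral) auto
    then show ?thesis
      using AHB[of k j] that S[OF that(2)] by (simp add: sum.remove[of _ i])
  qed
  have A_free: "A $$ (k, j) = 0" if "k < d" "j < n" "\<And>i. i < d \<Longrightarrow> j \<notin> S i" for j k
  proof -
    have "(\<Sum>i<d. H $$ (k, i) * B $$ (i, j)) = 0"
      using that S by (intro sum.neutral) auto
    then show ?thesis using AHB[OF that(1,2)] by simp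
  qed
  define m where "m i = Min (S i)" for i
  have m: "m i \<in> S i" if "i < d" for i
    using ne[OF that] ncS that finite_subset[of "S i" "{..<n}"]
    unfolding m_def noncrossing_partial_partition_def by (intro Min_in) auto
  \<comment> \<open>This sign switches at every index except the least elements of the
    blocks.\<close>
  define \<sigma> :: "nat \<Rightarrow> real" where "\<sigma> j = (-1) ^ (j + card {i\<in>{..<d}. Min (S i) \<le> j})" for j
  \<comment> \<open>The column sum is the only nonzero entry of the column; zero columns get the
    default value 1.\<close>
  define \<epsilon> where "\<epsilon> j = (if \<exists>i<d. j \<in> S i then real_of_rat (\<Sum>i<d. B $$ (i, j)) else 1)" for j
  have \<epsilon>: "\<epsilon> j = real_of_rat (B $$ (i, j))" if "i < d" "j \<in> S i" for i j
  proof -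
    have "(\<Sum>l<d. B $$ (l, j)) = B $$ (i, j)"
      using unit(2)[OF that] that(1) by (subst sum.remove[of _ i]) (auto intro: sum.neutral)
    then show ?thesis using that by (auto simp: \<epsilon>_def)
  qed
  have \<epsilon>1: "\<epsilon> j = 1 \<or> \<epsilon> j = -1" for j
  proof (cases "\<exists>i<d. j \<in> S i")
    case True
    then obtain i where i: "i < d" "j \<in> S i" by blast
    then have "B $$ (i, j) = 1 \<or> B $$ (i, j) = -1" using unit(1)[of i j] by (auto simp: abs_if split: if_splits)
    then show ?thesis using \<epsilon>[OF i] by auto
  qed (auto simp: \<epsilon>_def)
  have \<sigma>1: "\<sigma> j = 1 \<or> \<sigma> j = -1" for j
    unfolding \<sigma>_def by (cases "even (j + card {i\<in>{..<d}. Min (S i) \<le> j})") auto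
  define \<mu> where "\<mu> j = \<epsilon> j * \<sigma> j" for j
  have \<mu>1: "\<mu> j = 1 \<or> \<mu> j = -1" for j using \<epsilon>1[of j] \<sigma>1[of j] by (auto simp: \<mu>_def)
  define l where "l = vec n (\<lambda>j. complex_of_real (\<mu> j))"
  have lj: "l $ j = of_real (\<mu> j)" if "j < n" for j using that by (simp add: l_def)
  have l1: "l $ j \<in> {1, -1}" if "j < n" for j using \<mu>1[of j] lj[OF that] by auto
  have lc: "l \<in> carrier_vec n" by (simp add: l_def)
  with l1 have lt: "l \<in> complex_torus n" by (force simp: complex_torus_def)
  have "map_vec Im x \<notin> L - {0\<^sub>v n}"
    if L: "L \<in> positive_grassmannian (n - d) n" and x: "x \<in> toric_variety l A" for L x
  proof
    assume xL: "map_vec Im x \<in> L - {0\<^sub>v n}"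
    have xc: "x \<in> carrier_vec n" using x toric_variety_carrier[OF A] by blast
    define s where "s i = \<sigma> (m i) * Im (x $ m i)" for i
    have block: "\<exists>r>0. Im (x $ j) = \<sigma> j * r * s i" if ij: "i < d" "j \<in> S i" for i j
    proof -
      have jn: "j < n" "m i < n" using ij S m[OF ij(1)] by auto
      have \<epsilon>B: "\<epsilon> j = \<epsilon> (m i) \<longleftrightarrow> B $$ (i, j) = B $$ (i, m i)"
        using \<epsilon>[OF ij] \<epsilon>[OF ij(1) m[OF ij(1)]] by simp
      show ?thesis
      proof (cases "\<epsilon> j = \<epsilon> (m i)")
        case True
        then have same: "A $$ (k, j) = A $$ (k, m i)" if "k < d" for k
          using A_block[OF that ij] A_block[OF that ij(1) m[OF ij(1)]] \<epsilon>B by simp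
        have "x $ j * l $ m i + (- l $ j) * x $ m i = 0"
        proof (rule toric_variety_relation[OF A _ _ x])
          show "(\<lambda>x. x $ j * l $ m i + (- l $ j) * x $ m i) \<in> polynomial_functions n"
            using jn by (intro polynomial_functions.intros)
          show "scaled_monomial_map l A w $ j * l $ m i + (- l $ j) * scaled_monomial_map l A w $ m i = 0" for w
            using A jn same by (simp add: scaled_monomial_map_def)
        qed
        then have "x $ j * of_real (\<mu> (m i)) = of_real (\<mu> j) * x $ m i"
          using jn by (simp add: lj)
        from arg_cong[OF this, of Im] have "Im (x $ j) * \<mu> (m i) = \<mu> j * Im (x $ m i)"
          by simp
        then have "Im (x $ j) = \<sigma> j * 1 * s i"
          using True \<epsilon>1[of j] \<sigma>1[of j] \<sigma>1[of "m i"] by (auto simp: \<mu>_def s_def)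
        then show ?thesis by (intro exI[of _ 1]) auto
      next
        case False
        have "B $$ (i, j) = - B $$ (i, m i)"
          using False \<epsilon>B unit(1)[OF ij] unit(1)[OF ij(1) m[OF ij(1)]] by (auto simp: abs_if split: if_splits)
        then have opp: "A $$ (k, j) = - A $$ (k, m i)" if "k < d" for k
          using A_block[OF that ij] A_block[OF that ij(1) m[OF ij(1)]] by (simp flip: of_int_minus)
        have "x $ j * x $ m i + - (l $ j * l $ m i) = 0"
        proof (rule toric_variety_relation[OF A _ _ x])
          show "(\<lambda>x. x $ j * x $ m i + - (l $ j * l $ m i)) \<in> polynomial_functions n"
            using jn by (intro polynomial_functions.intros)
          fix w :: "complex vec" assume w: "w \<in> complex_torus d"
          have "(\<Prod>k<d. w $ k powi A $$ (k, j)) * (\<Prod>k<d. w $ k powi A $$ (k, m i)) = 1"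
            unfolding prod.distrib[symmetric] using w
            by (intro prod.neutral) (auto simp: opp power_int_minus complex_torus_def)
          then show "scaled_monomial_map l A w $ j * scaled_monomial_map l A w $ m i + - (l $ j * l $ m i) = 0"
            using A jn by (simp add: scaled_monomial_map_def mult_ac)
        qed
        then have prod: "x $ j * x $ m i = of_real (\<mu> j * \<mu> (m i))" using jn by (simp add: lj)
        moreover have "\<mu> j * \<mu> (m i) \<noteq> 0" using \<mu>1[of j] \<mu>1[of "m i"] by auto
        \<comment> \<open>The product relation also excludes a zero coordinate at the points outside
          the image of the torus.\<close>
        ultimately have nz: "x $ m i \<noteq> 0" by auto
        then have "x $ j = of_real (\<mu> j * \<mu> (m i)) / x $ m i"
          using prod by (simp add: eq_divide_eq)
        then have "Im (x $ j) = - (\<mu> j * \<mu> (m i)) * Im (x $ m i) / (cmod (x $ m i))\<^sup>2"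
          using Im_inverse_scaled by metis
        also have "\<mu> j * \<mu> (m i) = - (\<sigma> j * \<sigma> (m i))"
          using False \<epsilon>1[of j] \<epsilon>1[of "m i"] by (auto simp: \<mu>_def)
        finally have "Im (x $ j) = \<sigma> j * (1 / (cmod (x $ m i))\<^sup>2) * s i" by (simp add: s_def)
        moreover have "1 / (cmod (x $ m i))\<^sup>2 > 0" using nz by simp
        ultimately show ?thesis by blast
      qed
    qed
    \<comment> \<open>An index lies in at most one block, so the factor can be chosen as a function
      of the index alone.\<close>
    have "\<exists>r. \<forall>i<d. j \<in> S i \<longrightarrow> r > 0 \<and> Im (x $ j) = \<sigma> j * r * s i" for j
    proof (cases "\<exists>i<d. j \<in> S i")
      case True
      then obtain i where i: "i < d" "j \<in> S i" by blast
      moreover have "k = i" if "k < d" "j \<in> S k" for k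
        using unit(2)[OF i] that S[OF that(1)] by blast
      ultimately show ?thesis using block[OF i] by metis
    qed auto
    then obtain r where r: "\<And>i j. i < d \<Longrightarrow> j \<in> S i \<Longrightarrow> r j > 0 \<and> Im (x $ j) = \<sigma> j * r j * s i"
      by metis
    have free: "Im (x $ j) = 0" if j: "j < n" "\<And>i. i < d \<Longrightarrow> j \<notin> S i" for j
    proof -
      \<comment> \<open>A zero column makes the coordinate constant, equal to the real number
        \<open>l $ j\<close>.\<close>
      have "x $ j + - l $ j = 0"
      proof (rule toric_variety_relation[OF A _ _ x])
        show "(\<lambda>x. x $ j + - l $ j) \<in> polynomial_functions n"
          using j by (intro polynomial_functions.intros)
        show "scaled_monomial_map l A w $ j + - l $ j = 0" for w
          using A j A_free[OF _ j] by (simp add: scaled_monomial_map_def)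
      qed
      then show ?thesis using lj[OF j(1)] by simp
    qed
    obtain J \<eta> where J: "J \<subseteq> {..<n}" "card J = Suc (n - d)" "\<eta> \<noteq> 0"
      "\<And>j. j \<in> J \<Longrightarrow> \<eta> * Im (x $ j) * (-1) ^ card {i\<in>J. i < j} \<ge> 0"
      using noncrossing_imp_weakly_alternating[OF ncS ne d, of r "\<lambda>j. Im (x $ j)" s] r free
      unfolding \<sigma>_def by auto
    have "map_vec Im x = 0\<^sub>v n"
    proof (rule positive_grassmannian_weakly_alternating_eq_0[OF L _ J(1,2,3)])
      show "map_vec Im x \<in> L" using xL by blast
      fix j assume j: "j \<in> J"
      then have "map_vec Im x $ j = Im (x $ j)" using J(1) xc by auto
      then show "\<eta> * map_vec Im x $ j * (-1) ^ card {i\<in>J. i < j} \<ge> 0" using J(4)[OF j] by simp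
    qed
    then show False using xL by blast
  qed
  then have "positively_hyperbolic n (toric_variety l A)"
    using positively_hyperbolic_toric_variety_iff[OF A dim[OF lt] d dn] by blast
  then show ?thesis using lc l1 by blast
qed

theorem theorem4p5:
  fixes A :: "int mat" and d n :: nat
  assumes "A \<in> carrier_mat d n"
    and "d \<ge> 1"
    and "vec_space.rank d (map_mat rat_of_int A) = d"
  shows "((\<exists>l \<in> complex_torus n. positively_hyperbolic n (toric_variety l A))
            \<longleftrightarrow> noncrossing_up_to_GL A)
       \<and> (noncrossing_up_to_GL A \<longrightarrow>
            (\<exists>l \<in> carrier_vec n. (\<forall>i<n. l $ i \<in> {1, -1}) \<and>
               positively_hyperbolic n (toric_variety l A)))"
proof -
  have "map_mat rat_of_int A \<in> carrier_mat d n" using assms(1) by simp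
  from full_rank_column_basis[OF this assms(3)]
  obtain G b where G: "G \<in> carrier_mat d d" "invertible_mat G" and b: "\<And>i. i < d \<Longrightarrow> b i < n"
    and Gb: "\<And>i k. i < d \<Longrightarrow> k < d \<Longrightarrow>
      (G * map_mat rat_of_int A) $$ (i, b k) = (if i = k then 1 else 0)" by blast
  have dn: "d \<le> n"
    using vec_space.rank_le_nc[of "map_mat rat_of_int A" d n] assms(1,3) by simp
  have dim: "irreducible_dim n (toric_variety l A) = d" if "l \<in> complex_torus n" for l
    by (rule irreducible_dim_toric_variety[OF assms(1) G(1) that b Gb])
  have suff: "\<exists>l \<in> carrier_vec n. (\<forall>i<n. l $ i \<in> {1, -1}) \<and> positively_hyperbolic n (toric_variety l A)"
    if "noncrossing_up_to_GL A"
    by (rule noncrossing_imp_positively_hyperbolic[OF assms that dn dim])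
  moreover have "\<exists>l \<in> complex_torus n. positively_hyperbolic n (toric_variety l A)"
    if "noncrossing_up_to_GL A"
    using suff[OF that] by (force simp: complex_torus_def)
  ultimately show ?thesis
    using positively_hyperbolic_imp_noncrossing[OF assms(1,2) _ G b Gb dn] by blast
qed

end
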